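(* Let $R>0$ and let $f:\mathbb{R}^2\to\mathbb{R}$ be a non-negative, continuous function, compactly supported outside the disc of radius $R$ centered at the origin, written $f(r,\theta)$ in polar coordinates. Let $\mathcal{R}_{\mathcal{D}}f(\rho,\varphi)$ be its Radon transform on double circular arcs, and let $f_n(r)$ and $(\mathcal{R}_{\mathcal{D}}f)_n(\rho)$, $n\in\mathbb{Z}$, be the circular harmonic (Fourier) components of $f$ and $\mathcal{R}_{\mathcal{D}}f$. Then $f$ is completely recovered, via its circular harmonic components $f_n$, from the components $(\mathcal{R}_{\mathcal{D}}f)_n$ of the data: for every $n\in\mathbb{Z}$ and every $r>R$, $$f_n(r)=\frac{1}{\pi}\,\frac{d}{dr}\int_R^r \frac{\cosh\left(n\cosh^{-1}\left(\frac{r}{\rho}\right)\right)}{\rho\sqrt{\left(\frac{r}{\rho}\right)^2-1}}\;\frac{(\mathcal{R}_{\mathcal{D}}f)_n(\rho)}{2\cos\left(n\cos^{-1}\left(\frac{R}{\rho}\right)\right)}\,d\rho .$$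
   Context: Fix $R>0$. For $\rho\ge R$ and $\varphi\in[0,2\pi)$ put $\psi=\cos^{-1}(R/\rho)\in[0,\pi/2)$. Define two circular arcs in polar coordinates $(r,\theta)$, both lying on circles of diameter $\rho$ passing through the origin: $$\mathcal{A}_{C_1}(\rho,\varphi)=\{(r,\theta): r=\rho\cos(\theta-(\varphi+\psi)),\ \theta\in[\varphi,\varphi+2\psi]\},$$ $$\mathcal{A}_{C_2}(\rho,\varphi)=\{(r,\theta): r=\rho\cos(\theta-(\varphi-\psi)),\ \theta\in[\varphi-2\psi,\varphi]\}.$$ (These are the parts with $r\ge R$ of the two circles of diameter $\rho$ passing through the origin and through the point $R(\cos\varphi,\sin\varphi)$.) Let $\mathcal{D}(\rho,\varphi)=\mathcal{A}_{C_1}(\rho,\varphi)\cup\mathcal{A}_{C_2}(\rho,\varphi)$. The Radon transform on double circular arcs of $f$ is $$\mathcal{R}_{\mathcal{D}}f(\rho,\varphi)=\int_{\mathcal{D}(\rho,\varphi)}f(r,\theta)\,ds,$$ where $ds$ is arc length, i.e. the sum of the arc length integrals of $f$ over $\mathcal{A}_{C_1}(\rho,\varphi)$ and $\mathcal{A}_{C_2}(\rho,\varphi)$. The circular harmonic components are $$f_n(r)=\frac{1}{2\pi}\int_0^{2\pi}f(r,\theta)e^{-in\theta}\,d\theta,\qquad (\mathcal{R}_{\mathcal{D}}f)_n(\rho)=\frac{1}{2\pi}\int_0^{2\pi}\mathcal{R}_{\mathcal{D}}f(\rho,\varphi)e^{-in\varphi}\,d\varphi .$$ For fixed $n$ and $r$,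 the denominator $\cos(n\cos^{-1}(R/\rho))$ vanishes for at most finitely many $\rho\in[R,r]$; these points are disregarded in the integral. *)

theory Defs
  imports "HOL-Analysis.Analysis"
begin

definition polar :: "real \<Rightarrow> real \<Rightarrow> real \<times> real" where
  "polar r \<theta> = (r * cos \<theta>, r * sin \<theta>)"

definition arc_length_integral ::
  "(real \<Rightarrow> real \<times> real) \<Rightarrow> real \<Rightarrow> real \<Rightarrow> (real \<times> real \<Rightarrow> real) \<Rightarrow> real" where
  "arc_length_integral \<gamma> a b f =
     integral {a..b} (\<lambda>t. f (\<gamma> t) * norm (vector_derivative \<gamma> (at t)))"

definition psi :: "real \<Rightarrow> real \<Rightarrow> real" where
  "psi R \<rho> = arccos (R / \<rho>)"

(* The circle of diameter \<rho> through the origin whose diametrically opposite point is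
   polar \<rho> \<beta>, parametrised by the polar angle. *)
definition circ_curve :: "real \<Rightarrow> real \<Rightarrow> real \<Rightarrow> real \<times> real" where
  "circ_curve \<rho> \<beta> \<theta> = polar (\<rho> * cos (\<theta> - \<beta>)) \<theta>"

(* For R \<le> \<rho> the two arcs meet only in polar R \<phi>, so the integral over their union is the
   sum of the integrals over the arcs. *)
definition radon_arcs ::
  "real \<Rightarrow> (real \<times> real \<Rightarrow> real) \<Rightarrow> real \<Rightarrow> real \<Rightarrow> real" where
  "radon_arcs R f \<rho> \<phi> =
     arc_length_integral (circ_curve \<rho> (\<phi> + psi R \<rho>)) \<phi> (\<phi> + 2 * psi R \<rho>) f
   + arc_length_integral (circ_curve \<rho> (\<phi> - psi R \<rho>)) (\<phi> - 2 * psi R \<rho>) \<phi> f"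

definition fourier_component :: "int \<Rightarrow> (real \<Rightarrow> real) \<Rightarrow> complex" where
  "fourier_component n h =
     complex_of_real (1 / (2 * pi)) *
     integral {0..2 * pi} (\<lambda>t. complex_of_real (h t) * exp (- \<i> * of_int n * complex_of_real t))"

definition fun_component :: "(real \<times> real \<Rightarrow> real) \<Rightarrow> int \<Rightarrow> real \<Rightarrow> complex" where
  "fun_component f n r = fourier_component n (\<lambda>\<theta>. f (polar r \<theta>))"

definition radon_component :: "real \<Rightarrow> (real \<times> real \<Rightarrow> real) \<Rightarrow> int \<Rightarrow> real \<Rightarrow> complex" where
  "radon_component R f n \<rho> = fourier_component n (radon_arcs R f \<rho>)"

(* The disc is taken open, so the support may touch the circle of radius R; this includes
   functions supported outside the closed disc. *)
definition admissible :: "real \<Rightarrow> (real \<times> real \<Rightarrow> real) \<Rightarrow> bool" where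
  "admissible R f \<longleftrightarrow>
     (\<forall>x. 0 \<le> f x) \<and> continuous_on UNIV f \<and>
     compact (closure {x. f x \<noteq> 0}) \<and> closure {x. f x \<noteq> 0} \<inter> ball 0 R = {}"

(* Division by zero yields 0, so the integrand takes the value 0 at \<rho> = r and at the finitely
   many zeros of the cosine; these points do not affect the integral. *)
definition inversion_integrand ::
  "real \<Rightarrow> (real \<times> real \<Rightarrow> real) \<Rightarrow> int \<Rightarrow> real \<Rightarrow> real \<Rightarrow> complex" where
  "inversion_integrand R f n r \<rho> =
     complex_of_real (cosh (of_int n * arcosh (r / \<rho>)) / (\<rho> * sqrt ((r / \<rho>)\<^sup>2 - 1))) *
     (radon_component R f n \<rho> / complex_of_real (2 * cos (of_int n * arccos (R / \<rho>))))"

end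

theory Submission
  imports Defs "HOL-Complex_Analysis.Cauchy_Integral_Formula"
begin

text \<open>
  Let \<open>\<psi> = arccos (R / \<rho>)\<close>.  The two arcs for \<open>(\<rho>, \<phi>)\<close> are copies of one symmetric arc, rotated by
  \<open>\<phi> + \<psi>\<close> and \<open>\<phi> - \<psi>\<close>.  A rotation only multiplies a Fourier component by an exponential, so the
  \<open>n\<close>-th component of the data is
  \<open>2 cos (n \<psi>)\<close> times \<open>2 \<rho>\<close> times the integral of \<open>f_n (\<rho> cos \<alpha>) cos (n \<alpha>)\<close> over \<open>0 \<le> \<alpha> \<le> \<psi>\<close>
  (\<open>radon_component_eq\<close>).  The factor \<open>cos (n \<psi>)\<close> vanishes only on a null set of \<open>\<rho>\<close>; dividing by it
  leaves Cormack's transform of \<open>f_n\<close>, an integral of Abel type over \<open>R < x < \<rho>\<close> whose kernel contains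
  the Chebyshev polynomial at \<open>x / \<rho>\<close>.

  The outer integral of the inversion formula multiplies this by a kernel with the Chebyshev
  polynomial at \<open>s / \<rho>\<close>, which is what \<open>cosh (n arcosh (s / \<rho>))\<close> is, and integrates over \<open>R < \<rho> < s\<close>.
  After exchanging the integrals, the inner one over \<open>x < \<rho> < s\<close> equals \<open>\<pi> / 2\<close> for all \<open>n\<close>, \<open>x\<close> and \<open>s\<close>
  (\<open>cormack_identity\<close>).  The reason is Cauchy's formula: the product of the two Chebyshev values is
  the real part of one Chebyshev value at a point moving on half of a circle that encloses 1, and the
  integral picks out the value 1 of the polynomial at 1 (\<open>has_integral_chebyshev_circle\<close>).  So the outer
  integral is \<open>\<pi>\<close> times the integral of \<open>f_n\<close> from \<open>R\<close> to \<open>s\<close>, and its derivative is \<open>\<pi> f_n(s)\<close>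
  (\<open>inversion_has_vector_derivative\<close>).

  Hence equal data give equal Fourier components on every circle of radius greater than \<open>R\<close>.  A
  continuous function on a circle is determined by its Fourier components
  (\<open>fourier_components_zero_imp_zero\<close>), and in the closed disc of radius \<open>R\<close> an admissible function
  vanishes, so \<open>f\<close> itself is determined.
\<close>

section \<open>Chebyshev polynomials and a circle integral\<close>

text \<open>
  The Chebyshev polynomials of the first kind, over any commutative ring: the kernels involve
  them at real arguments on both sides of 1, and the circle integral below at complex ones.
\<close>
fun chebyshev :: "nat \<Rightarrow> 'a::comm_ring_1 \<Rightarrow> 'a" where
  "chebyshev 0 x = 1"
| "chebyshev (Suc 0) x = x"
| "chebyshev (Suc (Suc n)) x = 2 * x * chebyshev (Suc n) x - chebyshev n x"

lemma chebyshev_one [simp]: "chebyshev n 1 = 1"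
  by (induction n rule: induct_nat_012) auto

lemma chebyshev_cnj: "chebyshev n (cnj z) = cnj (chebyshev n z)"
  by (induction n rule: induct_nat_012) auto

lemma holomorphic_chebyshev [holomorphic_intros]: "chebyshev n holomorphic_on S"
proof (induction n rule: induct_nat_012)
  case 0
  then show ?case by (simp add: chebyshev.simps[abs_def])
next
  case 1
  then show ?case by (simp add: chebyshev.simps[abs_def])
next
  case (ge2 n)
  then show ?case by (auto simp add: chebyshev.simps[abs_def] intro!: holomorphic_intros)
qed

lemma continuous_chebyshev: "continuous_on S (chebyshev n :: 'a::real_normed_field \<Rightarrow> 'a)"
proof (induction n rule: induct_nat_012)
  case 0
  then show ?case by (simp add: chebyshev.simps[abs_def])
next
  case 1
  then show ?case by (simp add: chebyshev.simps[abs_def])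
next
  case (ge2 n)
  then show ?case by (auto simp add: chebyshev.simps[abs_def] intro!: continuous_intros)
qed

lemma cosh_times_nat: "cosh (of_nat n * z) = chebyshev n (cosh (z :: 'a::{real_normed_field,banach}))"
proof (induction n rule: induct_nat_012)
  case (ge2 n)
  have *: "of_nat (Suc (Suc n)) * z = of_nat (Suc n) * z + z" "of_nat n * z = of_nat (Suc n) * z - z"
    by (auto simp: algebra_simps)
  have "cosh (of_nat (Suc (Suc n)) * z) = 2 * cosh z * cosh (of_nat (Suc n) * z) - cosh (of_nat n * z)"
    unfolding * cosh_add cosh_diff by (simp add: algebra_simps)
  then show ?case using ge2 by simp
qed auto

lemma cos_times_nat: "cos (real n * t) = chebyshev n (cos t)"
proof (induction n rule: induct_nat_012)
  case (ge2 n)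
  have *: "real (Suc (Suc n)) * t = real (Suc n) * t + t" "real n * t = real (Suc n) * t - t"
    by (auto simp: algebra_simps)
  have "cos (real (Suc (Suc n)) * t) = 2 * cos t * cos (real (Suc n) * t) - cos (real n * t)"
    unfolding * cos_add cos_diff by (simp add: algebra_simps)
  then show ?case using ge2 by simp
qed auto

lemma cosh_Complex: "cosh (Complex u v) = Complex (cosh u * cos v) (sinh u * sin v)"
proof -
  have "cosh (Complex u v) = cosh (complex_of_real u) * cosh (\<i> * complex_of_real v)
      + sinh (complex_of_real u) * sinh (\<i> * complex_of_real v)"
    by (simp add: Complex_eq cosh_add)
  moreover have "cosh (complex_of_real u) = of_real (cosh u)" "sinh (complex_of_real u) = of_real (sinh u)"
    by (simp_all add: cosh_field_def sinh_field_def flip: exp_of_real)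
  moreover have "cosh (\<i> * complex_of_real v) = of_real (cos v)" "sinh (\<i> * complex_of_real v) = \<i> * of_real (sin v)"
    by (simp_all add: cosh_conv_cos sinh_conv_sin cos_of_real sin_of_real flip: mult.assoc)
  ultimately show ?thesis
    by (simp add: complex_eq_iff)
qed

text \<open>
  With \<open>a = cosh u\<close> and \<open>b = cos v\<close>, the product \<open>cosh (n u) cos (n v)\<close> is the real part of
  \<open>cosh (n (u + i v))\<close>, which is the Chebyshev polynomial at \<open>cosh (u + i v)\<close>.
\<close>
lemma chebyshev_mult_chebyshev:
  assumes "1 \<le> a" "\<bar>b\<bar> \<le> 1"
  shows "chebyshev n a * chebyshev n b = Re (chebyshev n (Complex (a * b) (sqrt (a\<^sup>2 - 1) * sqrt (1 - b\<^sup>2))))"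
proof -
  define u v where "u = arcosh a" and "v = arccos b"
  have u: "cosh u = a" "u \<ge> 0" using assms by (auto simp: u_def)
  have v: "cos v = b" "0 \<le> v" "v \<le> pi"
    using assms by (auto simp: v_def cos_arccos_abs arccos_lbound arccos_ubound)
  have "sqrt (a\<^sup>2 - 1) = sinh u"
    using u by (metis cosh_square_eq add_diff_cancel_right' real_sqrt_unique sinh_real_nonneg_iff)
  moreover have "sqrt (1 - b\<^sup>2) = sin v"
    using v by (metis sin_squared_eq real_sqrt_unique sin_ge_zero)
  ultimately have "Complex (a * b) (sqrt (a\<^sup>2 - 1) * sqrt (1 - b\<^sup>2)) = cosh (Complex u v)"
    using u v by (simp add: cosh_Complex)
  then have "Re (chebyshev n (Complex (a * b) (sqrt (a\<^sup>2 - 1) * sqrt (1 - b\<^sup>2))))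
      = Re (cosh (of_nat n * Complex u v))"
    by (simp only: cosh_times_nat)
  also have "of_nat n * Complex u v = Complex (of_nat n * u) (of_nat n * v)"
    by (simp add: complex_eq_iff)
  also have "Re (cosh \<dots>) = chebyshev n a * chebyshev n b"
    using u v by (simp add: cosh_Complex cosh_times_nat cos_times_nat)
  finally show ?thesis ..
qed

text \<open>
  The radius is chosen so that \<open>w = k + q exp (i t)\<close> satisfies \<open>w^2 - 1 = 2 (Re w) (w - k)\<close> on the
  circle.  Hence \<open>dt / (2 Re w)\<close> equals \<open>dw / (i (w^2 - 1))\<close>, and the circle encloses the pole 1 but
  not the pole \<open>-1\<close>, so that Cauchy's formula evaluates the integral over the full circle.  The
  result does not depend on \<open>m\<close> because every Chebyshev polynomial takes the value 1 at 1.
\<close>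
lemma has_integral_chebyshev_circle:
  fixes k q :: real
  assumes "k > 1" and q: "q = sqrt (k\<^sup>2 - 1)"
  shows "((\<lambda>t. Re (chebyshev m (of_real k + of_real q * cis t)) / (k + q * cos t)) has_integral pi) {0..pi}"
proof -
  have q2: "q\<^sup>2 = k\<^sup>2 - 1" using \<open>k > 1\<close> unfolding q by simp
  have "q > 0" using \<open>k > 1\<close> unfolding q by (simp add: one_less_power)
  have "q < k"
    by (rule power2_less_imp_less) (use \<open>k > 1\<close> q2 in auto)
  have "(k - 1)\<^sup>2 < q\<^sup>2"
    unfolding q2 using \<open>k > 1\<close> by (simp add: power2_eq_square algebra_simps)
  then have kq: "k - 1 < q"
    using \<open>q > 0\<close> by (simp add: power_less_imp_less_base)
  define w where "w t = of_real k + of_real q * cis t" for t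
  have Rew: "Re (w t) = k + q * cos t" for t by (simp add: w_def)
  have pos: "k + q * cos t > 0" for t
  proof -
    have "\<bar>q * cos t\<bar> \<le> q" using \<open>q > 0\<close> by (simp add: abs_mult)
    then show ?thesis using \<open>q < k\<close> by linarith
  qed
  have "((\<lambda>u. (chebyshev m u / (u + 1)) / (u - 1)) has_contour_integral
      (2 * of_real pi * \<i> * (chebyshev m 1 / (1 + 1)))) (circlepath (of_real k) q)"
  proof (rule Cauchy_integral_circlepath_simple)
    show "(\<lambda>u. chebyshev m u / (u + 1)) holomorphic_on cball (complex_of_real k) q"
    proof (intro holomorphic_intros)
      fix z assume z: "z \<in> cball (complex_of_real k) q"
      show "z + 1 \<noteq> 0"
      proof
        assume "z + 1 = 0"
        then have "Re z = -1" by (metis add_eq_0_iff2 one_complex.sel(1) uminus_complex.sel(1))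
        moreover have "\<bar>Re (of_real k - z)\<bar> \<le> q"
          using z abs_Re_le_cmod[of "of_real k - z"] by (simp add: dist_norm)
        ultimately show False using \<open>q < k\<close> \<open>k > 1\<close> by simp
      qed
    qed
    show "norm (1 - complex_of_real k) < q"
      using kq \<open>k > 1\<close> by (metis norm_minus_commute norm_of_real of_real_1 of_real_diff abs_of_pos diff_gt_0_iff_gt)
  qed
  then have "((\<lambda>t. chebyshev m (w t) / (w t + 1) / (w t - 1) * of_real q * \<i> * cis t) has_integral (\<i> * of_real pi)) {0..2*pi}"
    unfolding circlepath_def w_def by (subst (asm) has_contour_integral_part_circlepath_iff) (auto simp: mult_ac)
  moreover have "chebyshev m (w t) / (w t + 1) / (w t - 1) * of_real q * \<i> * cis t
     = \<i> * (chebyshev m (w t) / of_real (2 * Re (w t)))" for t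
  proof -
    have eq: "(w t + 1) * (w t - 1) = of_real (2 * Re (w t)) * (of_real q * cis t)"
      unfolding Rew w_def using q2 sin_cos_squared_add[of t]
      by (simp add: complex_eq_iff power2_eq_square) algebra
    have nz: "of_real q * cis t \<noteq> 0" "complex_of_real (2 * Re (w t)) \<noteq> 0"
      using \<open>q > 0\<close> pos[of t] unfolding Rew of_real_eq_0_iff by simp_all
    have "chebyshev m (w t) / (w t + 1) / (w t - 1) * of_real q * \<i> * cis t
       = \<i> * (chebyshev m (w t) * (of_real q * cis t) / ((w t + 1) * (w t - 1)))"
      by (simp add: divide_simps)
    also have "\<dots> = \<i> * (chebyshev m (w t) / of_real (2 * Re (w t)))"
      unfolding eq using nz by simp
    finally show ?thesis .
  qed
  ultimately have "((\<lambda>t. \<i> * (chebyshev m (w t) / of_real (2 * Re (w t)))) has_integral (\<i> * of_real pi)) {0..2*pi}"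
    by simp
  then have "((\<lambda>t. (-\<i>) * (\<i> * (chebyshev m (w t) / of_real (2 * Re (w t))))) has_integral (-\<i>) * (\<i> * of_real pi)) {0..2*pi}"
    by (rule has_integral_mult_right)
  then have "((\<lambda>t. chebyshev m (w t) / of_real (2 * Re (w t))) has_integral of_real pi) {0..2*pi}"
    by (simp add: mult.assoc[symmetric])
  then have "((\<lambda>t. Re (chebyshev m (w t) / of_real (2 * Re (w t)))) has_integral Re (of_real pi)) {0..2*pi}"
    by (rule has_integral_Re)
  moreover have eqg: "Re (chebyshev m (w t) / of_real (2 * Re (w t))) = Re (chebyshev m (w t)) / (k + q * cos t) / 2" for t
    using Rew by (simp add: Re_divide_of_real del: of_real_mult)
  define g where "g t = Re (chebyshev m (w t)) / (k + q * cos t)" for t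
  ultimately have "((\<lambda>t. g t / 2) has_integral pi) {0..2*pi}"
    by (simp add: Rew g_def mult.commute)
  from has_integral_mult_right[OF this, of 2] have g2: "(g has_integral 2 * pi) {0..2*pi}" by simp
  \<comment> \<open>The polynomial has real coefficients, so the two half circles contribute equally.\<close>
  have sym: "g (2 * pi - t) = g t" for t
  proof -
    have "w (2 * pi - t) = cnj (w t)"
      unfolding w_def by (simp add: complex_eq_iff cos_diff sin_diff)
    then show ?thesis by (simp add: g_def chebyshev_cnj cos_diff)
  qed
  have int: "g integrable_on {0..pi}" "g integrable_on {pi..2*pi}"
    by (rule integrable_on_subinterval[OF has_integral_integrable[OF g2]]; simp)+
  define J where "J = integral {0..pi} g"
  have J: "(g has_integral J) {0..pi}" unfolding J_def using int by auto
  have "((\<lambda>t. g (- 1 *\<^sub>R t + 2 * pi)) has_integral (1 / \<bar>- 1\<bar> ^ DIM(real)) *\<^sub>R J) ((\<lambda>x. (1 / - 1) *\<^sub>R x + - ((1 / - 1) *\<^sub>R (2 * pi))) ` cbox 0 pi)"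
    by (rule has_integral_affinity) (use J in auto)
  moreover have "(\<lambda>x. (1 / - 1) *\<^sub>R x + - ((1 / - 1) *\<^sub>R (2 * pi))) ` cbox 0 pi = {pi..2*pi}"
    by (auto simp: image_iff intro!: bexI[where x="2*pi - _"])
  moreover have "g (- 1 *\<^sub>R t + 2 * pi) = g t" for t using sym[of t] by simp
  ultimately have "(g has_integral J) {pi..2*pi}" by simp
  from has_integral_combine[OF _ _ J this] have "(g has_integral J + J) {0..2*pi}" by simp
  then have "J + J = 2 * pi" using g2 by (rule has_integral_unique)
  then show ?thesis using J unfolding g_def w_def by simp
qed

section \<open>Cormack's identity\<close>

text \<open>
  The kernel that appears at \<open>x < \<rho> < s\<close> when Cormack's transform and the transform that inverts
  it are composed.
\<close>
definition cormack_kernel :: "nat \<Rightarrow> real \<Rightarrow> real \<Rightarrow> real \<Rightarrow> real" where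
  "cormack_kernel m s x \<rho> = chebyshev m (s / \<rho>) * chebyshev m (x / \<rho>) * \<rho> / (sqrt (s\<^sup>2 - \<rho>\<^sup>2) * sqrt (\<rho>\<^sup>2 - x\<^sup>2))"

text \<open>
  By the product formula the two Chebyshev values multiply to the real part of the one at a point \<open>w\<close>
  with real part \<open>s x / \<rho>^2\<close>.  As \<open>\<rho>\<close> runs from \<open>x\<close> to \<open>s\<close>, this point moves along the upper half of the
  circle with centre \<open>k\<close> and radius \<open>q\<close>, where \<open>k + q = s / x\<close> and \<open>k - q = x / s\<close>.  Taking the angle on
  this circle as the new variable absorbs both square root singularities and leaves the
  integral over a half circle evaluated above.
\<close>
lemma cormack_identity:
  assumes "0 < x" "x < s"
  shows "cormack_kernel m s x absolutely_integrable_on {x<..<s}" "integral {x<..<s} (cormack_kernel m s x) = pi / 2"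
proof -
  define F where "F = cormack_kernel m s x"
  have "s > 0" using assms by simp
  define k q where "k = (s\<^sup>2 + x\<^sup>2) / (2 * s * x)" and "q = (s\<^sup>2 - x\<^sup>2) / (2 * s * x)"
  have "x\<^sup>2 < s\<^sup>2" using assms by (simp add: power_strict_mono)
  then have "q > 0" using \<open>0 < x\<close> \<open>0 < s\<close> by (simp add: q_def)
  have "(s - x)\<^sup>2 > 0" using assms by simp
  then have "k > 1" using \<open>0 < x\<close> \<open>0 < s\<close> by (simp add: k_def field_simps power2_eq_square)
  have q2: "q\<^sup>2 = k\<^sup>2 - 1"
    using \<open>0 < x\<close> \<open>0 < s\<close> by (simp add: k_def q_def field_simps power2_eq_square)
  have q: "q = sqrt (k\<^sup>2 - 1)" using \<open>q > 0\<close> q2 by (simp add: real_sqrt_unique)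
  have kpq: "k + q = s / x" and kmq: "k - q = x / s"
    using \<open>0 < x\<close> \<open>0 < s\<close> by (simp_all add: k_def q_def field_simps power2_eq_square)
  \<comment> \<open>D t is the real part of the point of the circle at angle t; solving D t = s x / \<rho>^2 for \<rho> gives g.\<close>
  define D where "D t = k + q * cos t" for t
  define g where "g t = sqrt (s * x / D t)" for t
  have D: "x / s < D t" "D t < s / x" if "t \<in> {0<..<pi}" for t
  proof -
    have "cos t < 1" "-1 < cos t"
      using that cos_monotone_0_pi[of 0 t] cos_monotone_0_pi[of t pi] by auto
    then have "q * cos t < q" "- q < q * cos t"
      using \<open>q > 0\<close> mult_strict_left_mono[of "-1" "cos t" q] by simp_all
    then show "x / s < D t" "D t < s / x" unfolding kpq[symmetric] kmq[symmetric] D_def by auto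
  qed
  have Dpos: "D t > 0" if "t \<in> {0<..<pi}" for t
    using D(1)[OF that] divide_pos_pos[OF \<open>0 < x\<close> \<open>0 < s\<close>] by linarith
  have g2: "(g t)\<^sup>2 = s * x / D t" if "t \<in> {0<..<pi}" for t
    using Dpos[OF that] \<open>0 < x\<close> \<open>0 < s\<close> by (simp add: g_def)
  have g_bounds: "x < g t" "g t < s" if "t \<in> {0<..<pi}" for t
  proof -
    have "x\<^sup>2 < (g t)\<^sup>2" "(g t)\<^sup>2 < s\<^sup>2"
      using D[OF that] Dpos[OF that] \<open>0 < x\<close> \<open>0 < s\<close>
      unfolding g2[OF that] by (simp_all add: field_simps power2_eq_square)
    moreover have "g t \<ge> 0" using Dpos[OF that] \<open>0 < x\<close> \<open>0 < s\<close> by (simp add: g_def)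
    ultimately show "x < g t" "g t < s"
      using \<open>0 < x\<close> \<open>0 < s\<close> by (auto intro: power2_less_imp_less)
  qed
  define g' where "g' t = g t * q * sin t / (2 * D t)" for t
  have deriv: "(g has_field_derivative g' t) (at t within {0<..<pi})" if t: "t \<in> {0<..<pi}" for t
  proof -
    have "g t > 0" using g_bounds[OF t] \<open>0 < x\<close> by linarith
    have "s * x / D t > 0" using Dpos[OF t] \<open>0 < x\<close> \<open>0 < s\<close> by simp
    have "((\<lambda>t. s * x / D t) has_field_derivative s * x * q * sin t / (D t)\<^sup>2) (at t within {0<..<pi})"
      using Dpos[OF t] unfolding D_def
      by (auto intro!: derivative_eq_intros simp: field_simps power2_eq_square)
    from DERIV_chain2[OF DERIV_real_sqrt[OF \<open>s * x / D t > 0\<close>] this]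
    have "(g has_field_derivative inverse (g t) / 2 * (s * x * q * sin t / (D t)\<^sup>2)) (at t within {0<..<pi})"
      unfolding g_def by simp
    moreover have "inverse (g t) / 2 * (s * x * q * sin t / (D t)\<^sup>2) = g' t"
    proof -
      have "inverse (g t) / 2 * (s * x * q * sin t / (D t)\<^sup>2) = inverse (g t) / 2 * ((s * x / D t) * q * sin t / D t)"
        by (simp add: power2_eq_square)
      also have "\<dots> = g' t"
        unfolding g2[OF t, symmetric] g'_def using \<open>g t > 0\<close> by (simp add: power2_eq_square)
      finally show ?thesis .
    qed
    ultimately show ?thesis by simp
  qed
  have inj: "inj_on g {0<..<pi}"
  proof
    fix a b assume ab: "a \<in> {0<..<pi}" "b \<in> {0<..<pi}" "g a = g b"
    then have "s * x / D a = s * x / D b" by (metis g2)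
    then have cos: "cos a = cos b" using Dpos[OF ab(1)] Dpos[OF ab(2)] \<open>0 < x\<close> \<open>0 < s\<close> \<open>q > 0\<close>
      by (simp add: field_simps D_def)
    show "a = b" by (rule cos_inj_pi[OF _ _ _ _ cos]) (use ab in auto)
  qed
  have image: "g ` {0<..<pi} = {x<..<s}"
  proof (intro equalityI subsetI)
    fix \<rho> assume \<rho>: "\<rho> \<in> {x<..<s}"
    define c where "c = (s * x / \<rho>\<^sup>2 - k) / q"
    have "\<rho> > 0" using \<rho> \<open>0 < x\<close> by auto
    then have "x\<^sup>2 < \<rho>\<^sup>2" "\<rho>\<^sup>2 < s\<^sup>2" using \<rho> \<open>0 < x\<close> by (auto simp: power_strict_mono)
    then have "s * x / \<rho>\<^sup>2 < s / x" "x / s < s * x / \<rho>\<^sup>2"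
      using \<open>0 < x\<close> \<open>0 < s\<close> \<open>\<rho> > 0\<close> by (simp_all add: field_simps power2_eq_square)
    then have c: "-1 < c" "c < 1"
      unfolding kpq[symmetric] kmq[symmetric] c_def using \<open>q > 0\<close> by (simp_all add: field_simps)
    have "arccos c \<in> {0<..<pi}" using arccos_lt_bounded[OF c] by simp
    moreover have "g (arccos c) = \<rho>"
      using c \<open>q > 0\<close> \<open>\<rho> > 0\<close> \<open>0 < x\<close> \<open>0 < s\<close> by (simp add: g_def D_def c_def real_sqrt_unique)
    ultimately show "\<rho> \<in> g ` {0<..<pi}" by blast
  qed (use g_bounds in auto)
  define w where "w t = of_real k + of_real q * cis t" for t
  have core: "\<bar>g' t\<bar> *\<^sub>R F (g t) = Re (chebyshev m (w t)) / D t * (1/2)" if t: "t \<in> {0<..<pi}" for t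
  proof -
    define \<rho> where "\<rho> = g t"
    have \<rho>: "x < \<rho>" "\<rho> < s" "\<rho> > 0" using g_bounds[OF t] \<open>0 < x\<close> unfolding \<rho>_def by linarith+
    have \<rho>2: "\<rho>\<^sup>2 = s * x / D t" using g2[OF t] by (simp add: \<rho>_def)
    have "D t > 0" using Dpos[OF t] .
    have "sin t > 0" using t by (simp add: sin_gt_zero)
    have prod: "s / \<rho> * (x / \<rho>) = D t"
      using \<rho>2 \<rho> \<open>D t > 0\<close> by (simp add: field_simps power2_eq_square)
    \<comment> \<open>The imaginary part of the product formula is that of the point of the circle.\<close>
    have "((s / \<rho>)\<^sup>2 - 1) * (1 - (x / \<rho>)\<^sup>2) = (q * sin t)\<^sup>2"
    proof -
      have "((s / \<rho>)\<^sup>2 - 1) * (1 - (x / \<rho>)\<^sup>2) = (s\<^sup>2 + x\<^sup>2) / \<rho>\<^sup>2 - 1 - (s / \<rho> * (x / \<rho>))\<^sup>2"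
        using \<rho> by (simp add: field_simps power2_eq_square)
      also have "(s\<^sup>2 + x\<^sup>2) / \<rho>\<^sup>2 = 2 * k * D t"
        unfolding \<rho>2 k_def using \<open>D t > 0\<close> \<open>0 < x\<close> \<open>0 < s\<close> by (simp add: field_simps)
      also have "2 * k * D t - 1 - (s / \<rho> * (x / \<rho>))\<^sup>2 = (k\<^sup>2 - 1) - (q * cos t)\<^sup>2"
        unfolding prod by (simp add: D_def power2_eq_square algebra_simps)
      also have "\<dots> = (q * sin t)\<^sup>2"
        by (simp add: q2[symmetric] power_mult_distrib sin_squared_eq algebra_simps)
      finally show ?thesis .
    qed
    then have im: "sqrt ((s / \<rho>)\<^sup>2 - 1) * sqrt (1 - (x / \<rho>)\<^sup>2) = q * sin t"
      using \<open>q > 0\<close> \<open>sin t > 0\<close> by (simp flip: real_sqrt_mult)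
    have "chebyshev m (s / \<rho>) * chebyshev m (x / \<rho>) = Re (chebyshev m (Complex (D t) (q * sin t)))"
      unfolding prod[symmetric] im[symmetric] using \<rho> \<open>0 < x\<close> by (intro chebyshev_mult_chebyshev) auto
    also have "Complex (D t) (q * sin t) = w t" by (simp add: w_def D_def complex_eq_iff)
    finally have ch: "chebyshev m (s / \<rho>) * chebyshev m (x / \<rho>) = Re (chebyshev m (w t))" .
    have "s\<^sup>2 - \<rho>\<^sup>2 = \<rho>\<^sup>2 * ((s / \<rho>)\<^sup>2 - 1)" "\<rho>\<^sup>2 - x\<^sup>2 = \<rho>\<^sup>2 * (1 - (x / \<rho>)\<^sup>2)"
      using \<rho> by (simp_all add: field_simps)
    then have "sqrt (s\<^sup>2 - \<rho>\<^sup>2) = \<rho> * sqrt ((s / \<rho>)\<^sup>2 - 1)" "sqrt (\<rho>\<^sup>2 - x\<^sup>2) = \<rho> * sqrt (1 - (x / \<rho>)\<^sup>2)"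
      using \<rho> by (simp_all add: real_sqrt_mult)
    then have "sqrt (s\<^sup>2 - \<rho>\<^sup>2) * sqrt (\<rho>\<^sup>2 - x\<^sup>2) = \<rho>\<^sup>2 * (q * sin t)"
      unfolding im[symmetric] by (simp add: power2_eq_square)
    then have "F \<rho> = Re (chebyshev m (w t)) * \<rho> / (\<rho>\<^sup>2 * (q * sin t))"
      unfolding F_def cormack_kernel_def ch by simp
    moreover have "\<bar>g' t\<bar> = \<rho> * (q * sin t) / (2 * D t)"
      using \<rho> \<open>q > 0\<close> \<open>sin t > 0\<close> \<open>D t > 0\<close> unfolding g'_def \<rho>_def[symmetric] by simp
    ultimately show ?thesis
      using \<rho> \<open>q > 0\<close> \<open>sin t > 0\<close> \<open>D t > 0\<close> by (simp add: \<rho>_def[symmetric] power2_eq_square)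
  qed
  have ge: "0 < k + q * cos t" for t
  proof -
    have "\<bar>q * cos t\<bar> \<le> q" using \<open>q > 0\<close> by (simp add: abs_mult)
    moreover have "k - q > 0" unfolding kmq using \<open>0 < x\<close> \<open>0 < s\<close> by simp
    ultimately show ?thesis by linarith
  qed
  have int: "((\<lambda>t. Re (chebyshev m (w t)) / D t * (1/2)) has_integral pi * (1/2)) {0..pi}"
    using has_integral_mult_left[OF has_integral_chebyshev_circle[OF \<open>k > 1\<close> q, of m], of "1/2"]
    by (simp add: w_def D_def)
  then have int': "((\<lambda>t. Re (chebyshev m (w t)) / D t * (1/2)) has_integral pi / 2) {0<..<pi}"
    unfolding box_real(1)[symmetric] has_integral_open_interval by simp
  have "continuous_on {0..pi} (\<lambda>t. chebyshev m (w t))"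
    unfolding w_def by (intro continuous_on_compose2[OF continuous_chebyshev[of UNIV]] continuous_intros) auto
  then have "continuous_on {0..pi} (\<lambda>t. Re (chebyshev m (w t)) / D t * (1/2))"
    unfolding D_def using ge by (intro continuous_intros) (auto simp: less_le)
  then have "(\<lambda>t. Re (chebyshev m (w t)) / D t * (1/2)) absolutely_integrable_on {0<..<pi}"
    using absolutely_integrable_on_open_interval[where f = "\<lambda>t. Re (chebyshev m (w t)) / D t * (1/2)" and a = 0 and b = pi]
    by (simp add: absolutely_integrable_continuous_real)
  then have "(\<lambda>t. \<bar>g' t\<bar> *\<^sub>R F (g t)) absolutely_integrable_on {0<..<pi}"
    by (subst set_integrable_cong[OF refl refl core]) auto
  moreover have "integral {0<..<pi} (\<lambda>t. \<bar>g' t\<bar> *\<^sub>R F (g t)) = pi / 2"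
    by (rule trans[OF integral_cong[OF core] integral_unique[OF int']])
  ultimately have "F absolutely_integrable_on g ` {0<..<pi} \<and> integral (g ` {0<..<pi}) F = pi / 2"
    using has_absolute_integral_change_of_variables_real[of "{0<..<pi}" g g' F "pi/2"] deriv inj by simp
  then show "cormack_kernel m s x absolutely_integrable_on {x<..<s}" "integral {x<..<s} (cormack_kernel m s x) = pi / 2"
    unfolding image F_def by auto
qed

section \<open>Inversion of the Abel type transform\<close>

lemma borel_measurable_chebyshev [measurable]: "(chebyshev m :: real \<Rightarrow> real) \<in> borel_measurable borel"
  by (rule borel_measurable_continuous_onI[OF continuous_chebyshev])

text \<open>
  The exchange of integrals takes place for the Lebesgue integral of Borel functions, the
  substitutions for absolutely integrable functions on intervals.  This lemma and the next one
  translate between the two.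
\<close>
lemma integrable_lborel_of_absolutely_integrable_on:
  fixes f :: "real \<Rightarrow> 'a::euclidean_space"
  assumes meas: "(\<lambda>x. if x \<in> S then f x else 0) \<in> borel_measurable borel"
    and f: "f absolutely_integrable_on S"
  shows "integrable lborel (\<lambda>x. if x \<in> S then f x else 0)"
    and "(LINT x|lborel. (if x \<in> S then f x else 0)) = integral S f"
proof -
  have eq: "(\<lambda>x. indicator S x *\<^sub>R f x) = (\<lambda>x. if x \<in> S then f x else 0)"
    by (auto simp: indicator_def)
  have meas': "(\<lambda>x. if x \<in> S then f x else 0) \<in> lborel \<rightarrow>\<^sub>M borel"
    using meas by simp
  show "integrable lborel (\<lambda>x. if x \<in> S then f x else 0)"
    using f unfolding set_integrable_def eq integrable_completion[OF meas'] .
  show "(LINT x|lborel. (if x \<in> S then f x else 0)) = integral S f"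
    using set_lebesgue_integral_eq_integral(2)[OF f]
    unfolding set_lebesgue_integral_def eq integral_completion[OF meas'] .
qed

lemma absolutely_integrable_on_of_integrable_lborel:
  fixes f :: "real \<Rightarrow> 'a::euclidean_space"
  assumes f: "integrable lborel (\<lambda>x. if x \<in> S then f x else 0)"
  shows "f absolutely_integrable_on S"
    and "integral S f = (LINT x|lborel. (if x \<in> S then f x else 0))"
proof -
  have eq: "(\<lambda>x. indicator S x *\<^sub>R f x) = (\<lambda>x. if x \<in> S then f x else 0)"
    by (auto simp: indicator_def)
  have meas': "(\<lambda>x. if x \<in> S then f x else 0) \<in> lborel \<rightarrow>\<^sub>M borel"
    using f by simp
  show *: "f absolutely_integrable_on S"
    using f unfolding set_integrable_def eq integrable_completion[OF meas'] .
  show "integral S f = (LINT x|lborel. (if x \<in> S then f x else 0))"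
    using set_lebesgue_integral_eq_integral(2)[OF *]
    unfolding set_lebesgue_integral_def eq integral_completion[OF meas'] by simp
qed

text \<open>
  The arc integral in its angular form becomes an integral of Abel type in the radius \<open>x\<close>, which
  is the form in which the order of integration can be exchanged.
\<close>
lemma abel_substitution:
  fixes h :: "real \<Rightarrow> complex" and m :: nat
  assumes h: "continuous_on UNIV h" and "0 < R" "R < \<rho>"
  defines "F \<equiv> (\<lambda>x. (chebyshev m (x / \<rho>) * \<rho> / sqrt (\<rho>\<^sup>2 - x\<^sup>2)) *\<^sub>R h x)"
  shows "F absolutely_integrable_on {R<..<\<rho>}"
    and "integral {R<..<\<rho>} F = \<rho> *\<^sub>R integral {0..arccos (R / \<rho>)} (\<lambda>\<alpha>. cos (real m * \<alpha>) *\<^sub>R h (\<rho> * cos \<alpha>))"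
proof -
  have "\<rho> > 0" using assms by simp
  define \<psi> where "\<psi> = arccos (R / \<rho>)"
  have cpsi: "cos \<psi> = R / \<rho>" using assms by (simp add: \<psi>_def cos_arccos_abs)
  have psi: "0 < \<psi>" "\<psi> < pi"
    using arccos_lt_bounded[of "R / \<rho>"] \<open>0 < R\<close> \<open>R < \<rho>\<close> divide_pos_pos[OF \<open>0 < R\<close> \<open>\<rho> > 0\<close>]
    by (auto simp: \<psi>_def)
  define g where "g \<alpha> = \<rho> * cos \<alpha>" for \<alpha>
  define g' where "g' \<alpha> = - \<rho> * sin \<alpha>" for \<alpha>
  define G where "G \<alpha> = \<rho> *\<^sub>R (cos (real m * \<alpha>) *\<^sub>R h (\<rho> * cos \<alpha>))" for \<alpha>
  have deriv: "(g has_field_derivative g' \<alpha>) (at \<alpha> within {0<..<\<psi>})" for \<alpha>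
    unfolding g_def g'_def by (auto intro!: derivative_eq_intros)
  have inj: "inj_on g {0<..<\<psi>}"
  proof
    fix a b assume ab: "a \<in> {0<..<\<psi>}" "b \<in> {0<..<\<psi>}" "g a = g b"
    then have cos: "cos a = cos b" using \<open>\<rho> > 0\<close> by (simp add: g_def)
    show "a = b" by (rule cos_inj_pi[OF _ _ _ _ cos]) (use ab psi in auto)
  qed
  have image: "g ` {0<..<\<psi>} = {R<..<\<rho>}"
  proof (intro equalityI subsetI)
    fix x assume "x \<in> g ` {0<..<\<psi>}"
    then obtain \<alpha> where "\<alpha> \<in> {0<..<\<psi>}" "x = g \<alpha>" by blast
    then have \<alpha>: "x = \<rho> * cos \<alpha>" "0 < \<alpha>" "\<alpha> < \<psi>" by (simp_all add: g_def)
    then have "cos \<alpha> < 1" "R / \<rho> < cos \<alpha>"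
      using psi cos_monotone_0_pi[of 0 \<alpha>] cos_monotone_0_pi[of \<alpha> \<psi>] by (auto simp: cpsi)
    then show "x \<in> {R<..<\<rho>}" using \<open>\<rho> > 0\<close> by (simp add: \<alpha>(1) field_simps)
  next
    fix x assume x: "x \<in> {R<..<\<rho>}"
    then have b: "-1 < x / \<rho>" "x / \<rho> < 1" "R / \<rho> < x / \<rho>"
      using assms \<open>\<rho> > 0\<close> by (auto simp: field_simps)
    have "arccos (x / \<rho>) \<in> {0<..<\<psi>}"
      using b assms arccos_lt_bounded[of "x / \<rho>"] arccos_less_arccos[of "R / \<rho>" "x / \<rho>"]
      unfolding \<psi>_def by (auto simp: field_simps)
    moreover have "x = g (arccos (x / \<rho>))"
      using b \<open>\<rho> > 0\<close> by (simp add: g_def)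
    ultimately show "x \<in> g ` {0<..<\<psi>}" by (rule rev_image_eqI)
  qed
  have core: "\<bar>g' \<alpha>\<bar> *\<^sub>R F (g \<alpha>) = G \<alpha>" if \<alpha>: "\<alpha> \<in> {0<..<\<psi>}" for \<alpha>
  proof -
    have "sin \<alpha> > 0" using \<alpha> psi by (intro sin_gt_zero) auto
    have "\<rho>\<^sup>2 - (g \<alpha>)\<^sup>2 = (\<rho> * sin \<alpha>)\<^sup>2"
      by (simp add: g_def power_mult_distrib sin_squared_eq algebra_simps)
    then have "sqrt (\<rho>\<^sup>2 - (g \<alpha>)\<^sup>2) = \<rho> * sin \<alpha>"
      using \<open>\<rho> > 0\<close> \<open>sin \<alpha> > 0\<close> by simp
    then show ?thesis
      using \<open>\<rho> > 0\<close> \<open>sin \<alpha> > 0\<close> unfolding F_def G_def g'_def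
      by (simp add: g_def cos_times_nat abs_mult)
  qed
  have cont: "continuous_on {0..\<psi>} G"
    unfolding G_def by (intro continuous_intros continuous_on_compose2[OF h]) auto
  then have "G absolutely_integrable_on {0<..<\<psi>}"
    using absolutely_integrable_on_open_interval[where f = G and a = 0 and b = \<psi>]
    by (simp add: absolutely_integrable_continuous_real)
  then have "(\<lambda>\<alpha>. \<bar>g' \<alpha>\<bar> *\<^sub>R F (g \<alpha>)) absolutely_integrable_on {0<..<\<psi>}"
    by (subst set_integrable_cong[OF refl refl core]) auto
  moreover have "integral {0<..<\<psi>} (\<lambda>\<alpha>. \<bar>g' \<alpha>\<bar> *\<^sub>R F (g \<alpha>)) = integral {0..\<psi>} G"
    using integral_open_interval[where f = G and a = 0 and b = \<psi>]
    by (subst integral_cong[OF core]) simp_all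
  ultimately have "F absolutely_integrable_on g ` {0<..<\<psi>} \<and> integral (g ` {0<..<\<psi>}) F = integral {0..\<psi>} G"
    using has_absolute_integral_change_of_variables_real[of "{0<..<\<psi>}" g g' F "integral {0..\<psi>} G"] deriv inj by simp
  then show "F absolutely_integrable_on {R<..<\<rho>}"
    "integral {R<..<\<rho>} F = \<rho> *\<^sub>R integral {0..arccos (R / \<rho>)} (\<lambda>\<alpha>. cos (real m * \<alpha>) *\<^sub>R h (\<rho> * cos \<alpha>))"
    unfolding image \<psi>_def[symmetric] G_def integral_cmul by blast+
qed

text \<open>
  For index 0 the kernel is non-negative, so by Tonelli's theorem the identity for the inner
  integral already gives integrability over the triangle.  Up to a constant factor this kernel
  dominates those of all other indices.
\<close>
lemma integrable_cormack_kernel: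
  assumes "0 < R" "R < s"
  shows "integrable (lborel \<Otimes>\<^sub>M lborel) (\<lambda>(x, \<rho>). if R < x \<and> x < \<rho> \<and> \<rho> < s then cormack_kernel 0 s x \<rho> else 0)"
    (is "integrable _ ?f")
proof (rule lborel_pair.Fubini_integrable)
  show "?f \<in> borel_measurable (lborel \<Otimes>\<^sub>M lborel)"
    unfolding cormack_kernel_def by measurable
  have slice: "(\<lambda>\<rho>. ?f (x, \<rho>)) = (\<lambda>\<rho>. if \<rho> \<in> {x<..<s} then cormack_kernel 0 s x \<rho> else 0)" if "R < x" for x
    using that by auto
  have meas: "(\<lambda>\<rho>. if \<rho> \<in> {x<..<s} then cormack_kernel 0 s x \<rho> else 0) \<in> borel_measurable borel" for x
    unfolding cormack_kernel_def by measurable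
  have int: "integrable lborel (\<lambda>\<rho>. ?f (x, \<rho>))" "(LINT \<rho>|lborel. ?f (x, \<rho>)) = (if x < s then pi/2 else 0)" if "R < x" for x
  proof -
    have "integrable lborel (\<lambda>\<rho>. ?f (x, \<rho>)) \<and> (LINT \<rho>|lborel. ?f (x, \<rho>)) = (if x < s then pi/2 else 0)"
    proof (cases "x < s")
      case True
      have "0 < x" using that assms by simp
      from cormack_identity[OF this True, of 0]
      show ?thesis unfolding slice[OF that]
        using integrable_lborel_of_absolutely_integrable_on[OF meas[of x]] True by simp
    next
      case False
      then have "(\<lambda>\<rho>. ?f (x, \<rho>)) = (\<lambda>\<rho>. 0)" by auto
      then show ?thesis using False by simp
    qed
    then show "integrable lborel (\<lambda>\<rho>. ?f (x, \<rho>))" "(LINT \<rho>|lborel. ?f (x, \<rho>)) = (if x < s then pi/2 else 0)" by auto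
  qed
  show "AE x in lborel. integrable lborel (\<lambda>\<rho>. ?f (x, \<rho>))"
  proof (intro AE_I2)
    fix x :: real
    show "integrable lborel (\<lambda>\<rho>. ?f (x, \<rho>))"
      by (cases "R < x") (use int in auto)
  qed
  have "(\<lambda>x. LINT \<rho>|lborel. norm (?f (x, \<rho>))) = (\<lambda>x. if x \<in> {R<..<s} then pi/2 else 0)"
  proof
    fix x
    have "(\<lambda>\<rho>. norm (?f (x, \<rho>))) = (\<lambda>\<rho>. ?f (x, \<rho>))"
    proof
      fix \<rho>
      have "cormack_kernel 0 s x \<rho> \<ge> 0" if "R < x" "x < \<rho>" "\<rho> < s"
        using that assms by (simp add: cormack_kernel_def power_mono)
      then show "norm (?f (x, \<rho>)) = ?f (x, \<rho>)" by auto
    qed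
    then show "(LINT \<rho>|lborel. norm (?f (x, \<rho>))) = (if x \<in> {R<..<s} then pi/2 else 0)"
      using int(2)[of x] by (cases "R < x") auto
  qed
  moreover have "integrable lborel (\<lambda>x. if x \<in> {R<..<s} then pi/2 else 0 :: real)"
  proof (rule integrable_lborel_of_absolutely_integrable_on)
    show "(\<lambda>x. pi/2 :: real) absolutely_integrable_on {R<..<s}"
      using absolutely_integrable_on_open_interval[where f = "\<lambda>x. pi/2" and a = R and b = s]
      by (simp add: absolutely_integrable_continuous_real)
  qed measurable
  ultimately show "integrable lborel (\<lambda>x. LINT \<rho>|lborel. norm (?f (x, \<rho>)))" by simp
qed

text \<open>
  The two sides of the equation are iterated integrals of the same function over the triangle \<open>R < x < \<rho> < s\<close>.  The
  integral over \<open>x\<close> produces the transform of \<open>h\<close>; the integral over \<open>\<rho>\<close> is constant in \<open>x\<close> by the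
  identity for the kernel, and only \<open>h\<close> remains.
\<close>
lemma abel_inversion:
  fixes h :: "real \<Rightarrow> complex" and m :: nat
  assumes h: "continuous_on UNIV h" and "0 < R" "R < s"
  defines "W \<equiv> (\<lambda>\<rho>. (chebyshev m (s / \<rho>) / sqrt (s\<^sup>2 - \<rho>\<^sup>2)) *\<^sub>R
     (\<rho> *\<^sub>R integral {0..arccos (R / \<rho>)} (\<lambda>\<alpha>. cos (real m * \<alpha>) *\<^sub>R h (\<rho> * cos \<alpha>))))"
  shows "W absolutely_integrable_on {R<..<s}"
    and "integral {R<..<s} W = (pi / 2) *\<^sub>R integral {R..s} h"
proof -
  have [measurable]: "h \<in> borel_measurable borel" by (rule borel_measurable_continuous_onI[OF h])
  define \<Phi> where "\<Phi> x \<rho> = (if R < x \<and> x < \<rho> \<and> \<rho> < s then cormack_kernel m s x \<rho> *\<^sub>R h x else 0)" for x \<rho>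
  have meas[measurable]: "(\<lambda>(x, \<rho>). \<Phi> x \<rho>) \<in> borel_measurable (lborel \<Otimes>\<^sub>M lborel)"
    unfolding \<Phi>_def cormack_kernel_def by measurable
  \<comment> \<open>On the triangle both arguments of the Chebyshev polynomials lie in a fixed compact interval,
    so the kernel is at most a constant times the one of index 0.\<close>
  obtain B where B: "\<And>y. y \<in> {R/s..s/R} \<Longrightarrow> \<bar>chebyshev m y\<bar> \<le> B"
  proof -
    have "bounded ((chebyshev m :: real \<Rightarrow> real) ` {R/s..s/R})"
      by (intro compact_imp_bounded compact_continuous_image continuous_chebyshev) auto
    then show thesis using that unfolding bounded_iff by (metis image_eqI real_norm_def)
  qed
  obtain H where H: "\<And>x. x \<in> {R..s} \<Longrightarrow> norm (h x) \<le> H"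
  proof -
    have "bounded (h ` {R..s})"
      by (intro compact_imp_bounded compact_continuous_image continuous_on_subset[OF h]) auto
    then show thesis using that unfolding bounded_iff by (metis image_eqI)
  qed
  have "H \<ge> 0" using H[of R] \<open>R < s\<close> by (intro order.trans[OF norm_ge_zero[of "h R"]]) simp
  have int: "integrable (lborel \<Otimes>\<^sub>M lborel) (\<lambda>(x, \<rho>). \<Phi> x \<rho>)"
  proof (rule Bochner_Integration.integrable_bound[OF integrable_mult_right[OF integrable_cormack_kernel[OF \<open>0 < R\<close> \<open>R < s\<close>], of "B * B * H"] meas])
    show "AE z in lborel \<Otimes>\<^sub>M lborel. norm (case z of (x, \<rho>) \<Rightarrow> \<Phi> x \<rho>)
      \<le> norm (B * B * H * (case z of (x, \<rho>) \<Rightarrow> if R < x \<and> x < \<rho> \<and> \<rho> < s then cormack_kernel 0 s x \<rho> else 0))"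
    proof (intro AE_I2, clarify)
      fix x \<rho>
      show "norm (\<Phi> x \<rho>) \<le> norm (B * B * H * (if R < x \<and> x < \<rho> \<and> \<rho> < s then cormack_kernel 0 s x \<rho> else 0))"
      proof (cases "R < x \<and> x < \<rho> \<and> \<rho> < s")
        case True
        have "s / \<rho> \<in> {R/s..s/R}" "x / \<rho> \<in> {R/s..s/R}"
          unfolding atLeastAtMost_iff by (intro conjI frac_le; use True assms(2,3) in linarith)+
        then have BB: "\<bar>chebyshev m (s / \<rho>)\<bar> * \<bar>chebyshev m (x / \<rho>)\<bar> \<le> B * B"
          by (intro mult_mono B order.trans[OF abs_ge_zero B]) auto
        have K0: "cormack_kernel 0 s x \<rho> \<ge> 0" using True assms(2,3) by (simp add: cormack_kernel_def power_mono)
        have "cormack_kernel m s x \<rho> = chebyshev m (s / \<rho>) * chebyshev m (x / \<rho>) * cormack_kernel 0 s x \<rho>" by (simp add: cormack_kernel_def)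
        then have "norm (\<Phi> x \<rho>) = \<bar>chebyshev m (s / \<rho>)\<bar> * \<bar>chebyshev m (x / \<rho>)\<bar> * cormack_kernel 0 s x \<rho> * norm (h x)"
          using True K0 by (simp add: \<Phi>_def abs_mult)
        also have "\<dots> \<le> B * B * cormack_kernel 0 s x \<rho> * H"
          using True K0 by (intro mult_mono[OF mult_right_mono[OF BB K0] H]) auto
        also have "\<dots> \<le> \<bar>B * B * H * cormack_kernel 0 s x \<rho>\<bar>" by (simp add: mult_ac)
        finally show ?thesis using True by simp
      qed (auto simp: \<Phi>_def)
    qed
  qed
  have sliceW: "(LINT x|lborel. \<Phi> x \<rho>) = (if \<rho> \<in> {R<..<s} then W \<rho> else 0)" for \<rho>
  proof (cases "\<rho> \<in> {R<..<s}")
    case True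
    define F where "F x = (chebyshev m (x / \<rho>) * \<rho> / sqrt (\<rho>\<^sup>2 - x\<^sup>2)) *\<^sub>R h x" for x
    have F: "F absolutely_integrable_on {R<..<\<rho>}"
       "integral {R<..<\<rho>} F = \<rho> *\<^sub>R integral {0..arccos (R / \<rho>)} (\<lambda>\<alpha>. cos (real m * \<alpha>) *\<^sub>R h (\<rho> * cos \<alpha>))"
      using abel_substitution[OF h \<open>0 < R\<close>, of \<rho> m] True unfolding F_def by auto
    have meas: "(\<lambda>x. if x \<in> {R<..<\<rho>} then F x else 0) \<in> borel_measurable borel"
      unfolding F_def by measurable
    have "(LINT x|lborel. \<Phi> x \<rho>) = (LINT x|lborel. (chebyshev m (s / \<rho>) / sqrt (s\<^sup>2 - \<rho>\<^sup>2)) *\<^sub>R (if x \<in> {R<..<\<rho>} then F x else 0))"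
      using True by (intro Bochner_Integration.integral_cong) (auto simp: \<Phi>_def F_def cormack_kernel_def)
    also have "\<dots> = W \<rho>"
      unfolding W_def F(2)[symmetric] integrable_lborel_of_absolutely_integrable_on(2)[OF meas F(1), symmetric]
      by (rule integral_scaleR_right)
    finally show ?thesis using True by simp
  next
    case False
    then have "(\<lambda>x. \<Phi> x \<rho>) = (\<lambda>x. 0)" by (auto simp: \<Phi>_def)
    then show ?thesis using False by auto
  qed
  have sliceh: "(LINT \<rho>|lborel. \<Phi> x \<rho>) = (pi / 2) *\<^sub>R (if x \<in> {R<..<s} then h x else 0)" for x
  proof (cases "x \<in> {R<..<s}")
    case True
    then have "0 < x" "x < s" using assms by auto
    have meas: "(\<lambda>\<rho>. if \<rho> \<in> {x<..<s} then cormack_kernel m s x \<rho> else 0) \<in> borel_measurable borel"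
      unfolding cormack_kernel_def by measurable
    note ck = cormack_identity[OF \<open>0 < x\<close> \<open>x < s\<close>, of m]
    have "(LINT \<rho>|lborel. \<Phi> x \<rho>) = (LINT \<rho>|lborel. (if \<rho> \<in> {x<..<s} then cormack_kernel m s x \<rho> else 0) *\<^sub>R h x)"
      using True by (intro Bochner_Integration.integral_cong) (auto simp: \<Phi>_def)
    also have "\<dots> = (pi / 2) *\<^sub>R h x"
      using integrable_lborel_of_absolutely_integrable_on[OF meas ck(1)] ck(2) by (subst integral_scaleR_left) auto
    finally show ?thesis using True by simp
  next
    case False
    then have "(\<lambda>\<rho>. \<Phi> x \<rho>) = (\<lambda>\<rho>. 0)" by (auto simp: \<Phi>_def)
    then show ?thesis using False by auto
  qed
  have "integrable lborel (\<lambda>\<rho>. LINT x|lborel. \<Phi> x \<rho>)"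
    using lborel_pair.integrable_snd[OF int] .
  then have Wint: "integrable lborel (\<lambda>\<rho>. if \<rho> \<in> {R<..<s} then W \<rho> else 0)"
    unfolding sliceW .
  show "W absolutely_integrable_on {R<..<s}"
    by (rule absolutely_integrable_on_of_integrable_lborel(1)[OF Wint])
  have habs: "h absolutely_integrable_on {R<..<s}"
    using absolutely_integrable_on_open_interval[where f = h and a = R and b = s]
      absolutely_integrable_continuous_real[OF continuous_on_subset[OF h, of "{R..s}"]] by simp
  have "integral {R<..<s} W = (LINT \<rho>|lborel. LINT x|lborel. \<Phi> x \<rho>)"
    unfolding absolutely_integrable_on_of_integrable_lborel(2)[OF Wint] sliceW ..
  also have "\<dots> = (LINT x|lborel. LINT \<rho>|lborel. \<Phi> x \<rho>)"
    by (rule lborel_pair.Fubini_integral[OF int])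
  also have "\<dots> = (pi / 2) *\<^sub>R (LINT x|lborel. (if x \<in> {R<..<s} then h x else 0))"
    unfolding sliceh by (rule integral_scaleR_right)
  also have "(LINT x|lborel. (if x \<in> {R<..<s} then h x else 0)) = integral {R<..<s} h"
    by (rule integrable_lborel_of_absolutely_integrable_on(2)[OF _ habs]) measurable
  also have "\<dots> = integral {R..s} h"
    using integral_open_interval[where f = h and a = R and b = s] by simp
  finally show "integral {R<..<s} W = (pi / 2) *\<^sub>R integral {R..s} h" .
qed

section \<open>Fourier components of the double arc transform\<close>

lemma continuous_on_polar:
  fixes S :: "'a::t2_space set"
  assumes "continuous_on UNIV f" "continuous_on S a" "continuous_on S b"
  shows "continuous_on S (\<lambda>z. f (polar (a z) (b z)))"
  unfolding polar_def
  by (intro continuous_on_compose2[OF assms(1)] continuous_intros assms) auto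

text \<open>
  Parametrised by the polar angle, the circle of diameter \<open>\<rho>\<close> through the origin has constant speed
  \<open>\<rho>\<close>, because the central angle is twice the angle at the origin.  Measuring the angle from the
  axis \<open>\<beta>\<close> makes the arc symmetric and frees its shape from \<open>\<beta>\<close>.
\<close>
lemma arc_length_integral_circ_curve:
  assumes "0 \<le> \<rho>"
  shows "arc_length_integral (circ_curve \<rho> \<beta>) (\<beta> - \<psi>) (\<beta> + \<psi>) f
      = integral {-\<psi>..\<psi>} (\<lambda>\<alpha>. \<rho> * f (polar (\<rho> * cos \<alpha>) (\<alpha> + \<beta>)))"
proof -
  have speed: "norm (vector_derivative (circ_curve \<rho> \<beta>) (at t)) = \<rho>" for t
  proof -
    have "(circ_curve \<rho> \<beta> has_vector_derivative (- \<rho> * sin (2 * t - \<beta>), \<rho> * cos (2 * t - \<beta>))) (at t)"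
    proof -
      have "((\<lambda>t. \<rho> * cos (t - \<beta>) * cos t) has_vector_derivative - \<rho> * sin (t - \<beta> + t)) (at t)"
        "((\<lambda>t. \<rho> * cos (t - \<beta>) * sin t) has_vector_derivative \<rho> * cos (t - \<beta> + t)) (at t)"
        unfolding has_real_derivative_iff_has_vector_derivative[symmetric] sin_add cos_add
        by (auto intro!: derivative_eq_intros simp: algebra_simps)
      moreover have "t - \<beta> + t = 2 * t - \<beta>" by simp
      ultimately show ?thesis
        unfolding circ_curve_def[abs_def] polar_def by (simp add: has_vector_derivative_Pair)
    qed
    then have "vector_derivative (circ_curve \<rho> \<beta>) (at t) = (- \<rho> * sin (2 * t - \<beta>), \<rho> * cos (2 * t - \<beta>))"
      by (rule vector_derivative_at)
    moreover have "(\<rho> * sin (2 * t - \<beta>))\<^sup>2 + (\<rho> * cos (2 * t - \<beta>))\<^sup>2 = \<rho>\<^sup>2"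
      by (simp add: power_mult_distrib flip: distrib_left)
    ultimately show ?thesis using assms by (simp add: norm_Pair)
  qed
  have "arc_length_integral (circ_curve \<rho> \<beta>) (\<beta> - \<psi>) (\<beta> + \<psi>) f
      = integral {-\<psi> + \<beta>..\<psi> + \<beta>} (\<lambda>t. \<rho> * f (circ_curve \<rho> \<beta> t))"
    unfolding arc_length_integral_def speed by (simp add: mult.commute add.commute)
  also have "\<dots> = integral {-\<psi>..\<psi>} (\<lambda>\<alpha>. \<rho> * f (polar (\<rho> * cos \<alpha>) (\<alpha> + \<beta>)))"
    unfolding integral_shift_Icc_real[symmetric] by (simp add: o_def circ_curve_def add.commute)
  finally show ?thesis .
qed

lemma radon_arcs_eq:
  assumes f: "continuous_on UNIV f" and "0 \<le> \<rho>"
  shows "radon_arcs R f \<rho> \<phi> = integral {- psi R \<rho>..psi R \<rho>} (\<lambda>\<alpha>. \<rho> *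
     (f (polar (\<rho> * cos \<alpha>) (\<phi> + (\<alpha> + psi R \<rho>))) + f (polar (\<rho> * cos \<alpha>) (\<phi> + (\<alpha> - psi R \<rho>)))))"
proof -
  let ?p = "psi R \<rho>"
  have int: "(\<lambda>\<alpha>. \<rho> * f (polar (\<rho> * cos \<alpha>) (\<alpha> + b))) integrable_on {-?p..?p}" for b
    by (intro integrable_continuous_real continuous_intros continuous_on_polar[OF f])
  have "radon_arcs R f \<rho> \<phi> =
     arc_length_integral (circ_curve \<rho> (\<phi> + ?p)) ((\<phi> + ?p) - ?p) ((\<phi> + ?p) + ?p) f
   + arc_length_integral (circ_curve \<rho> (\<phi> - ?p)) ((\<phi> - ?p) - ?p) ((\<phi> - ?p) + ?p) f"
    unfolding radon_arcs_def by (simp add: algebra_simps)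
  also have "\<dots> = integral {-?p..?p} (\<lambda>\<alpha>. \<rho> * f (polar (\<rho> * cos \<alpha>) (\<alpha> + (\<phi> + ?p))) + \<rho> * f (polar (\<rho> * cos \<alpha>) (\<alpha> + (\<phi> - ?p))))"
    unfolding arc_length_integral_circ_curve[OF \<open>0 \<le> \<rho>\<close>] by (rule integral_add[symmetric]) (rule int)+
  finally show ?thesis by (simp add: algebra_simps)
qed

lemma integral_periodic:
  fixes g :: "real \<Rightarrow> 'a::banach"
  assumes g: "continuous_on UNIV g" and per: "\<And>t. g (t + T) = g t" and "0 \<le> T"
  shows "integral {a..a + T} g = integral {0..T} g"
proof -
  have le: "integral {b..b + T} g = integral {a..a + T} g" if "a \<le> b" for a b
  proof -
    have int: "g integrable_on {x..y}" for x y
      by (rule integrable_continuous_real[OF continuous_on_subset[OF g]]) auto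
    have "integral {a..a + T} g + integral {a + T..b + T} g = integral {a..b + T} g"
      by (rule Henstock_Kurzweil_Integration.integral_combine) (use that \<open>0 \<le> T\<close> int in auto)
    moreover have "integral {a..b} g + integral {b..b + T} g = integral {a..b + T} g"
      by (rule Henstock_Kurzweil_Integration.integral_combine) (use that \<open>0 \<le> T\<close> int in auto)
    moreover have "integral {a + T..b + T} g = integral {a..b} g"
      unfolding integral_shift_Icc_real[symmetric] using per by (simp add: o_def add.commute)
    ultimately show ?thesis by (metis add.commute add_left_cancel)
  qed
  show ?thesis using le[of 0 a] le[of a 0] by (cases "0 \<le> a") auto
qed

lemma fourier_component_shift:
  assumes h: "continuous_on UNIV h" and per: "\<And>t. h (t + 2 * pi) = h t"
  shows "fourier_component n (\<lambda>t. h (t + c)) = exp (\<i> * of_int n * of_real c) * fourier_component n h"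
proof -
  define g where "g t = complex_of_real (h t) * exp (- \<i> * of_int n * complex_of_real t)" for t
  have "exp (- (\<i> * complex_of_int n * (2 * pi))) = 1"
    using exp_integer_2pi[of "of_int (-n)"] by (simp add: mult_ac)
  then have "g (t + 2 * pi) = g t" for t
    unfolding g_def per by (simp add: distrib_left exp_diff exp_minus exp_add minus_add_distrib)
  moreover have "continuous_on UNIV g"
    unfolding g_def by (intro continuous_intros h)
  ultimately have per': "integral {c..c + 2 * pi} g = integral {0..2*pi} g"
    by (intro integral_periodic) auto
  have "complex_of_real (h (t + c)) * exp (- \<i> * of_int n * complex_of_real t)
      = exp (\<i> * of_int n * of_real c) * g (t + c)" for t
    by (simp add: g_def algebra_simps flip: exp_add)
  then have "fourier_component n (\<lambda>t. h (t + c)) = complex_of_real (1 / (2 * pi)) *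
      (exp (\<i> * of_int n * of_real c) * integral {0..2*pi} (\<lambda>t. g (t + c)))"
    unfolding fourier_component_def by simp
  also have "integral {0..2*pi} (\<lambda>t. g (t + c)) = integral {c..c + 2*pi} g"
    using integral_shift_Icc_real[of 0 "2*pi" g c] by (simp add: o_def add.commute)
  finally show ?thesis unfolding per' by (simp add: fourier_component_def g_def[abs_def])
qed

lemma polar_2pi: "polar r (t + 2 * pi) = polar r t"
  by (simp add: polar_def)

lemma continuous_fun_component:
  assumes f: "continuous_on UNIV f"
  shows "continuous_on UNIV (fun_component f n)"
proof -
  have "continuous_on UNIV (\<lambda>r. integral (cbox 0 (2 * pi)) (\<lambda>t. complex_of_real (f (polar r t)) * exp (- \<i> * of_int n * complex_of_real t)))"
    by (rule integral_continuous_on_param)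
      (auto simp: case_prod_unfold intro!: continuous_intros continuous_on_polar[OF f])
  then show ?thesis
    unfolding fun_component_def[abs_def] fourier_component_def by (intro continuous_intros) simp
qed

text \<open>
  A point of either arc at angle \<open>\<alpha>\<close> from its axis has polar angle \<open>\<phi> + \<alpha> \<plusminus> \<psi>\<close>.  Fourier transformation in
  \<open>\<phi>\<close> under the integral turns these shifts into the factors \<open>exp (i n (\<alpha> \<plusminus> \<psi>))\<close>; their sum contains
  the constant \<open>2 cos (n \<psi>)\<close>, and the remaining \<open>exp (i n \<alpha>)\<close> reduces to its even part because the
  radius \<open>\<rho> cos \<alpha>\<close> is even in \<open>\<alpha>\<close>.
\<close>
lemma radon_component_eq:
  assumes f: "continuous_on UNIV f" and "0 < R" "R \<le> \<rho>"
  shows "radon_component R f n \<rho> = 2 * of_real (2 * cos (of_int n * arccos (R / \<rho>))) *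
     (\<rho> *\<^sub>R integral {0..arccos (R / \<rho>)} (\<lambda>\<alpha>. cos (real (nat \<bar>n\<bar>) * \<alpha>) *\<^sub>R fun_component f n (\<rho> * cos \<alpha>)))"
proof -
  define \<psi> where "\<psi> = arccos (R / \<rho>)"
  have "0 \<le> \<rho>" using assms by simp
  have "0 < R / \<rho>" "R / \<rho> \<le> 1" using assms by auto
  then have "0 \<le> \<psi>" unfolding \<psi>_def by (intro arccos_lbound) auto
  define e where "e t = exp (\<i> * of_int n * complex_of_real t)" for t
  define h where "h \<alpha> t = f (polar (\<rho> * cos \<alpha>) t)" for \<alpha> t
  have hcont: "continuous_on UNIV (h \<alpha>)" and hper: "h \<alpha> (t + 2 * pi) = h \<alpha> t" for \<alpha> t
    unfolding h_def polar_2pi by (auto intro!: continuous_on_polar[OF f] continuous_intros)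
  define J where "J \<phi> \<alpha> = complex_of_real (\<rho> * (h \<alpha> (\<phi> + (\<alpha> + \<psi>)) + h \<alpha> (\<phi> + (\<alpha> - \<psi>)))) * exp (- \<i> * of_int n * complex_of_real \<phi>)" for \<phi> \<alpha>
  define fc where "fc = fun_component f n"
  have fc: "continuous_on UNIV fc" unfolding fc_def by (rule continuous_fun_component[OF f])
  have "complex_of_real (radon_arcs R f \<rho> \<phi>) * exp (- \<i> * of_int n * complex_of_real \<phi>) = integral {-\<psi>..\<psi>} (J \<phi>)" for \<phi>
  proof -
    let ?k = "\<lambda>\<alpha>. \<rho> * (h \<alpha> (\<phi> + (\<alpha> + \<psi>)) + h \<alpha> (\<phi> + (\<alpha> - \<psi>)))"
    have "?k integrable_on {-\<psi>..\<psi>}"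
      unfolding h_def by (intro integrable_continuous_real continuous_intros continuous_on_polar[OF f])
    then have "((\<lambda>\<alpha>. complex_of_real (?k \<alpha>)) has_integral of_real (integral {-\<psi>..\<psi>} ?k)) {-\<psi>..\<psi>}"
      by (intro has_integral_of_real integrable_integral)
    from has_integral_mult_left[OF this, of "exp (- \<i> * of_int n * complex_of_real \<phi>)"]
    show ?thesis
      unfolding J_def radon_arcs_eq[OF f \<open>0 \<le> \<rho>\<close>] psi_def \<psi>_def[symmetric] h_def
      by (rule integral_unique[symmetric])
  qed
  then have "radon_component R f n \<rho> = complex_of_real (1 / (2 * pi)) * integral {0..2*pi} (\<lambda>\<phi>. integral {-\<psi>..\<psi>} (J \<phi>))"
    unfolding radon_component_def fourier_component_def by simp
  also have "integral {0..2*pi} (\<lambda>\<phi>. integral {-\<psi>..\<psi>} (J \<phi>)) = integral {-\<psi>..\<psi>} (\<lambda>\<alpha>. integral {0..2*pi} (\<lambda>\<phi>. J \<phi> \<alpha>))"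
  proof -
    have "continuous_on (cbox (0, -\<psi>) (2*pi, \<psi>)) (\<lambda>(\<phi>, \<alpha>). J \<phi> \<alpha>)"
      unfolding J_def h_def case_prod_unfold by (intro continuous_intros continuous_on_polar[OF f])
    from integral_swap_continuous[OF this] show ?thesis by simp
  qed
  also have "complex_of_real (1 / (2 * pi)) * \<dots> = integral {-\<psi>..\<psi>} (\<lambda>\<alpha>. complex_of_real (1 / (2 * pi)) * integral {0..2*pi} (\<lambda>\<phi>. J \<phi> \<alpha>))"
    by simp
  also have "\<dots> = integral {-\<psi>..\<psi>} (\<lambda>\<alpha>. of_real (2 * cos (of_int n * \<psi>)) * (\<rho> *\<^sub>R (e \<alpha> * fc (\<rho> * cos \<alpha>))))"
  proof (rule integral_cong)
    fix \<alpha>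
    have int: "(\<lambda>\<phi>. complex_of_real (h \<alpha> (\<phi> + c)) * exp (- \<i> * of_int n * complex_of_real \<phi>)) integrable_on {0..2*pi}" for c
      unfolding h_def by (intro integrable_continuous_real continuous_intros continuous_on_polar[OF f])
    have "complex_of_real (1 / (2 * pi)) * integral {0..2*pi} (\<lambda>\<phi>. J \<phi> \<alpha>)
       = complex_of_real (1 / (2 * pi)) * (\<rho> * (integral {0..2*pi} (\<lambda>\<phi>. complex_of_real (h \<alpha> (\<phi> + (\<alpha> + \<psi>))) * exp (- \<i> * of_int n * complex_of_real \<phi>)
          + complex_of_real (h \<alpha> (\<phi> + (\<alpha> - \<psi>))) * exp (- \<i> * of_int n * complex_of_real \<phi>))))"
      unfolding J_def by (simp add: ring_distribs mult.assoc flip: integral_mult_right)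
    also have "\<dots> = \<rho> * (fourier_component n (\<lambda>t. h \<alpha> (t + (\<alpha> + \<psi>))) + fourier_component n (\<lambda>t. h \<alpha> (t + (\<alpha> - \<psi>))))"
      unfolding fourier_component_def integral_add[OF int int] by (simp add: algebra_simps)
    also have "\<dots> = \<rho> * ((e (\<alpha> + \<psi>) + e (\<alpha> - \<psi>)) * fc (\<rho> * cos \<alpha>))"
      unfolding fourier_component_shift[OF hcont hper] e_def fc_def fun_component_def
      by (simp add: h_def[abs_def] ring_distribs)
    also have "e (\<alpha> + \<psi>) + e (\<alpha> - \<psi>) = of_real (2 * cos (of_int n * \<psi>)) * e \<alpha>"
    proof -
      have e_cis: "e t = cis (of_int n * t)" for t by (simp add: e_def cis_conv_exp mult_ac)
      show ?thesis unfolding e_cis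
        by (simp add: complex_eq_iff distrib_left right_diff_distrib cos_add cos_diff sin_add sin_diff)
    qed
    finally show "complex_of_real (1 / (2 * pi)) * integral {0..2*pi} (\<lambda>\<phi>. J \<phi> \<alpha>)
       = of_real (2 * cos (of_int n * \<psi>)) * (\<rho> *\<^sub>R (e \<alpha> * fc (\<rho> * cos \<alpha>)))"
      by (simp add: scaleR_conv_of_real mult_ac)
  qed
  also have "\<dots> = of_real (2 * cos (of_int n * \<psi>)) * (\<rho> *\<^sub>R integral {-\<psi>..\<psi>} (\<lambda>\<alpha>. e \<alpha> * fc (\<rho> * cos \<alpha>)))"
    by simp
  also have "integral {-\<psi>..\<psi>} (\<lambda>\<alpha>. e \<alpha> * fc (\<rho> * cos \<alpha>))
     = 2 * integral {0..\<psi>} (\<lambda>\<alpha>. cos (real (nat \<bar>n\<bar>) * \<alpha>) *\<^sub>R fc (\<rho> * cos \<alpha>))"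
  proof -
    let ?u = "\<lambda>\<alpha>. e \<alpha> * fc (\<rho> * cos \<alpha>)"
    have cont: "continuous_on S ?u" for S
      unfolding e_def by (intro continuous_intros continuous_on_compose2[OF fc]) auto
    have "integral {-\<psi>..\<psi>} ?u = integral {-\<psi>..0} ?u + integral {0..\<psi>} ?u"
      by (rule Henstock_Kurzweil_Integration.integral_combine[symmetric])
        (use \<open>0 \<le> \<psi>\<close> in \<open>auto intro!: integrable_continuous_real cont\<close>)
    also have "integral {-\<psi>..0} ?u = integral {0..\<psi>} (\<lambda>\<alpha>. ?u (- \<alpha>))"
      using Henstock_Kurzweil_Integration.integral_reflect_real[of "\<psi>" 0 "\<lambda>\<alpha>. ?u (- \<alpha>)"] by simp
    also have "\<dots> + integral {0..\<psi>} ?u = integral {0..\<psi>} (\<lambda>\<alpha>. ?u (- \<alpha>) + ?u \<alpha>)"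
      by (intro integral_add[symmetric] integrable_continuous_real cont
        continuous_on_compose2[OF cont] continuous_intros) auto
    also have "(\<lambda>\<alpha>. ?u (- \<alpha>) + ?u \<alpha>) = (\<lambda>\<alpha>. 2 * (cos (real (nat \<bar>n\<bar>) * \<alpha>) *\<^sub>R fc (\<rho> * cos \<alpha>)))"
    proof
      fix \<alpha>
      have e_cis: "e t = cis (of_int n * t)" for t by (simp add: e_def cis_conv_exp mult_ac)
      have "cos (real (nat \<bar>n\<bar>) * \<alpha>) = cos (of_int n * \<alpha>)"
        by (cases "n \<ge> 0") simp_all
      then have "e (- \<alpha>) + e \<alpha> = 2 * of_real (cos (real (nat \<bar>n\<bar>) * \<alpha>))"
        unfolding e_cis by (simp add: complex_eq_iff)
      then have "(e (- \<alpha>) + e \<alpha>) * fc (\<rho> * cos \<alpha>) = 2 * of_real (cos (real (nat \<bar>n\<bar>) * \<alpha>)) * fc (\<rho> * cos \<alpha>)"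
        by simp
      then show "?u (- \<alpha>) + ?u \<alpha> = 2 * (cos (real (nat \<bar>n\<bar>) * \<alpha>) *\<^sub>R fc (\<rho> * cos \<alpha>))"
        by (simp add: scaleR_conv_of_real ring_distribs)
    qed
    finally show ?thesis unfolding integral_mult_right .
  qed
  finally show ?thesis unfolding fc_def \<psi>_def by (simp add: scaleR_conv_of_real mult_ac)
qed

section \<open>The inversion formula\<close>

text \<open>
  Away from the zeros of the cosine the denominator cancels the factor that the double arc
  contributes to the data, and the integrand is twice the one of the Abel inversion.
\<close>
lemma inversion_integrand_eq:
  assumes f: "continuous_on UNIV f" and "0 < R" "R < \<rho>" "\<rho> < s"
    and nz: "cos (of_int n * arccos (R / \<rho>)) \<noteq> 0"
  shows "inversion_integrand R f n s \<rho> = 2 *\<^sub>R ((chebyshev (nat \<bar>n\<bar>) (s / \<rho>) / sqrt (s\<^sup>2 - \<rho>\<^sup>2)) *\<^sub>R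
     (\<rho> *\<^sub>R integral {0..arccos (R / \<rho>)} (\<lambda>\<alpha>. cos (real (nat \<bar>n\<bar>) * \<alpha>) *\<^sub>R fun_component f n (\<rho> * cos \<alpha>))))"
proof -
  have "\<rho> > 0" using assms by simp
  have "cosh (of_int n * arcosh (s / \<rho>)) = cosh (real (nat \<bar>n\<bar>) * arcosh (s / \<rho>))"
    by (cases "n \<ge> 0") simp_all
  also have "\<dots> = chebyshev (nat \<bar>n\<bar>) (s / \<rho>)"
    unfolding cosh_times_nat using \<open>\<rho> > 0\<close> \<open>\<rho> < s\<close> by simp
  finally have c: "cosh (of_int n * arcosh (s / \<rho>)) = chebyshev (nat \<bar>n\<bar>) (s / \<rho>)" .
  have "s\<^sup>2 - \<rho>\<^sup>2 = \<rho>\<^sup>2 * ((s / \<rho>)\<^sup>2 - 1)" using \<open>\<rho> > 0\<close> by (simp add: field_simps)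
  then have q: "\<rho> * sqrt ((s / \<rho>)\<^sup>2 - 1) = sqrt (s\<^sup>2 - \<rho>\<^sup>2)"
    using \<open>\<rho> > 0\<close> by (simp add: real_sqrt_mult)
  have *: "2 * of_real (2 * a) * z / of_real (2 * a) = 2 * z" if "a \<noteq> 0" for a and z :: complex
    using that by simp
  show ?thesis
    unfolding inversion_integrand_def c q radon_component_eq[OF f \<open>0 < R\<close> less_imp_le[OF \<open>R < \<rho>\<close>]] *[OF nz]
    by (simp add: scaleR_conv_of_real)
qed

text \<open>
  At a zero the angle is an odd multiple of \<open>\<pi> / (2 n)\<close>, so the zeros are countably many.
\<close>
lemma negligible_cos_zeros:
  assumes "0 < R"
  shows "negligible {\<rho>. R < \<rho> \<and> cos (of_int n * arccos (R / \<rho>)) = 0}"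
proof -
  let ?c = "\<lambda>i::int. R / cos (of_int i * (pi / 2) / of_int n)"
  have "{\<rho>. R < \<rho> \<and> cos (of_int n * arccos (R / \<rho>)) = 0} \<subseteq> range ?c"
  proof
    fix \<rho> assume "\<rho> \<in> {\<rho>. R < \<rho> \<and> cos (of_int n * arccos (R / \<rho>)) = 0}"
    then have "R < \<rho>" and c0: "cos (of_int n * arccos (R / \<rho>)) = 0" by auto
    then have "n \<noteq> 0" by auto
    obtain i :: int where i: "of_int n * arccos (R / \<rho>) = of_int i * (pi / 2)"
      using c0 unfolding cos_zero_iff_int by blast
    then have "arccos (R / \<rho>) = of_int i * (pi / 2) / of_int n"
      using \<open>n \<noteq> 0\<close> by (simp add: field_simps)
    moreover have "cos (arccos (R / \<rho>)) = R / \<rho>"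
      using \<open>0 < R\<close> \<open>R < \<rho>\<close> by (simp add: cos_arccos_abs)
    ultimately have "\<rho> = ?c i" using \<open>0 < R\<close> \<open>R < \<rho>\<close> by simp
    then show "\<rho> \<in> range ?c" by (rule range_eqI)
  qed
  moreover have "negligible (range ?c)"
    using negligible_countable_Union[of "range (\<lambda>i. {?c i})"] by (auto simp: UNION_singleton_eq_range)
  ultimately show ?thesis by (rule negligible_subset[rotated])
qed

lemma integral_inversion_integrand:
  assumes f: "continuous_on UNIV f" and "0 < R" "R < s"
  shows "inversion_integrand R f n s absolutely_integrable_on {R..s}"
    and "integral {R..s} (inversion_integrand R f n s) = pi *\<^sub>R integral {R..s} (fun_component f n)"
proof -
  let ?I = "inversion_integrand R f n s"
  let ?Z = "{\<rho>. R < \<rho> \<and> cos (of_int n * arccos (R / \<rho>)) = 0}"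
  define W where "W \<rho> = (chebyshev (nat \<bar>n\<bar>) (s / \<rho>) / sqrt (s\<^sup>2 - \<rho>\<^sup>2)) *\<^sub>R
     (\<rho> *\<^sub>R integral {0..arccos (R / \<rho>)} (\<lambda>\<alpha>. cos (real (nat \<bar>n\<bar>) * \<alpha>) *\<^sub>R fun_component f n (\<rho> * cos \<alpha>)))" for \<rho>
  note abel = abel_inversion[OF continuous_fun_component[OF f] \<open>0 < R\<close> \<open>R < s\<close>, of "nat \<bar>n\<bar>" n, folded W_def]
  have eq: "?I \<rho> = 2 *\<^sub>R W \<rho>" if "\<rho> \<in> {R<..<s} - ?Z" for \<rho>
    using that inversion_integrand_eq[OF f \<open>0 < R\<close>, of \<rho> s n] unfolding W_def by auto
  have "(\<lambda>\<rho>. 2 *\<^sub>R W \<rho>) absolutely_integrable_on {R<..<s}"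
    using absolutely_integrable_linear[OF abel(1) bounded_linear_scaleR_right[of 2]] by (simp add: o_def)
  then have "?I absolutely_integrable_on {R<..<s}"
    by (rule absolutely_integrable_spike[OF _ negligible_cos_zeros[OF \<open>0 < R\<close>] eq])
  then show "?I absolutely_integrable_on {R..s}"
    using absolutely_integrable_on_open_interval[where f = ?I and a = R and b = s] by simp
  have "integral {R..s} ?I = integral {R<..<s} ?I"
    using integral_open_interval[where f = ?I and a = R and b = s] by simp
  also have "\<dots> = integral {R<..<s} (\<lambda>\<rho>. 2 *\<^sub>R W \<rho>)"
    by (rule integral_spike[OF negligible_cos_zeros[OF \<open>0 < R\<close>] eq[symmetric]])
  also have "\<dots> = 2 *\<^sub>R integral {R<..<s} W" by (rule integral_cmul)
  also have "\<dots> = pi *\<^sub>R integral {R..s} (fun_component f n)" unfolding abel(2) by simp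
  finally show "integral {R..s} ?I = pi *\<^sub>R integral {R..s} (fun_component f n)" .
qed

lemma inversion_has_vector_derivative:
  assumes f: "continuous_on UNIV f" and "0 < R" "R < r"
  shows "((\<lambda>s. integral {R..s} (inversion_integrand R f n s)) has_vector_derivative
     pi *\<^sub>R fun_component f n r) (at r)"
proof -
  have "((\<lambda>s. integral {R..s} (fun_component f n)) has_vector_derivative fun_component f n r) (at r within {R..r + 1})"
    by (rule integral_has_vector_derivative)
      (use \<open>R < r\<close> in \<open>auto intro: continuous_on_subset[OF continuous_fun_component[OF f]]\<close>)
  then have "((\<lambda>s. integral {R..s} (fun_component f n)) has_vector_derivative fun_component f n r) (at r)"
    by (subst (asm) at_within_Icc_at) (use \<open>R < r\<close> in auto)
  then have "((\<lambda>s. pi *\<^sub>R integral {R..s} (fun_component f n)) has_vector_derivative pi *\<^sub>R fun_component f n r) (at r)"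
    by (intro derivative_eq_intros) auto
  then show ?thesis
  proof (rule has_vector_derivative_transform_within_open[of _ _ _ "{R<..}"])
    show "pi *\<^sub>R integral {R..s} (fun_component f n) = integral {R..s} (inversion_integrand R f n s)"
      if "s \<in> {R<..}" for s
      using that integral_inversion_integrand(2)[OF f \<open>0 < R\<close>, of s n] by simp
  qed (use \<open>R < r\<close> in auto)
qed

section \<open>Uniqueness of Fourier components on a circle\<close>

text \<open>
  Continuity is part of the notion because it makes the coefficients of a sum the sums of the
  coefficients.
\<close>
definition zero_spectrum :: "(real \<Rightarrow> complex) \<Rightarrow> bool" where
  "zero_spectrum d \<longleftrightarrow> continuous_on UNIV d \<and>
     (\<forall>n::int. integral {0..2 * pi} (\<lambda>t. d t * exp (- \<i> * of_int n * complex_of_real t)) = 0)"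

lemma zero_spectrum_add:
  assumes u: "zero_spectrum u" and v: "zero_spectrum v"
  shows "zero_spectrum (\<lambda>t. u t + v t)"
proof -
  have cont: "continuous_on S u" "continuous_on S v" for S
    using u v unfolding zero_spectrum_def by (blast intro: continuous_on_subset)+
  have "integral {0..2 * pi} (\<lambda>t. (u t + v t) * exp (- \<i> * of_int n * complex_of_real t))
     = integral {0..2 * pi} (\<lambda>t. u t * exp (- \<i> * of_int n * complex_of_real t))
     + integral {0..2 * pi} (\<lambda>t. v t * exp (- \<i> * of_int n * complex_of_real t))" for n
    unfolding distrib_right
    by (intro integral_add integrable_continuous_real continuous_intros cont)
  moreover have "continuous_on UNIV (\<lambda>t. u t + v t)" by (intro continuous_intros cont)
  ultimately show ?thesis using u v unfolding zero_spectrum_def by simp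
qed

text \<open>
  On a circle a linear function is a combination of \<open>exp (i t)\<close> and \<open>exp (-i t)\<close>, and multiplication
  by these shifts the Fourier coefficients.  Stating the lemma for every \<open>d\<close> makes
  products immediate: one factor of the polynomial is absorbed after the other.
\<close>
lemma zero_spectrum_mult_polynomial:
  assumes "real_polynomial_function p" and "zero_spectrum d"
  shows "zero_spectrum (\<lambda>t. d t * complex_of_real (p (polar r t)))"
  using assms
proof (induction arbitrary: d rule: real_polynomial_function.induct)
  case (linear l)
  have d: "continuous_on S d" for S
    using linear unfolding zero_spectrum_def by (blast intro: continuous_on_subset)
  have d0: "integral {0..2 * pi} (\<lambda>t. d t * exp (- \<i> * of_int n * complex_of_real t)) = 0" for n
    using linear unfolding zero_spectrum_def by blast
  \<comment> \<open>The coefficients of exp (i t) and exp (-i t) in r l(1,0) cos t + r l(0,1) sin t.\<close>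
  define a b where "a = r / 2 * (complex_of_real (l (1, 0)) - \<i> * l (0, 1))"
    and "b = r / 2 * (complex_of_real (l (1, 0)) + \<i> * l (0, 1))"
  have l: "complex_of_real (l (polar r t)) * exp (- \<i> * of_int n * complex_of_real t)
     = a * exp (- \<i> * of_int (n - 1) * complex_of_real t) + b * exp (- \<i> * of_int (n + 1) * complex_of_real t)"
    for n t
  proof -
    have p: "polar r t = (r * cos t) *\<^sub>R (1, 0) + (r * sin t) *\<^sub>R (0, 1)" by (simp add: polar_def)
    have "l (polar r t) = r * cos t * l (1, 0) + r * sin t * l (0, 1)"
      unfolding p linear_add[OF bounded_linear.linear[OF linear.hyps]] linear_scale[OF bounded_linear.linear[OF linear.hyps]]
      by simp
    then have "complex_of_real (l (polar r t)) = a * cis t + b * cis (- t)"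
      by (simp add: a_def b_def complex_eq_iff field_simps)
    moreover have "exp (- \<i> * of_int (n - 1) * complex_of_real t) = exp (- \<i> * of_int n * complex_of_real t) * cis t"
      "exp (- \<i> * of_int (n + 1) * complex_of_real t) = exp (- \<i> * of_int n * complex_of_real t) * cis (- t)"
      by (simp_all add: cis_conv_exp algebra_simps flip: exp_add)
    ultimately show ?thesis by (simp add: algebra_simps)
  qed
  have "integral {0..2 * pi} (\<lambda>t. d t * complex_of_real (l (polar r t)) * exp (- \<i> * of_int n * complex_of_real t)) = 0" for n
  proof -
    have "integral {0..2 * pi} (\<lambda>t. d t * complex_of_real (l (polar r t)) * exp (- \<i> * of_int n * complex_of_real t))
      = integral {0..2 * pi} (\<lambda>t. a * (d t * exp (- \<i> * of_int (n - 1) * complex_of_real t)) + b * (d t * exp (- \<i> * of_int (n + 1) * complex_of_real t)))"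
      by (intro integral_cong)
        (simp only: mult.assoc[of "d _" "complex_of_real (l _)"] l distrib_left mult.left_commute[of "d _"])
    also have "\<dots> = a * integral {0..2 * pi} (\<lambda>t. d t * exp (- \<i> * of_int (n - 1) * complex_of_real t))
       + b * integral {0..2 * pi} (\<lambda>t. d t * exp (- \<i> * of_int (n + 1) * complex_of_real t))"
      unfolding integral_mult_right[symmetric]
      by (intro integral_add integrable_continuous_real continuous_intros d)
    finally show ?thesis unfolding d0 by simp
  qed
  moreover have "continuous_on UNIV (\<lambda>t. d t * complex_of_real (l (polar r t)))"
    by (intro continuous_intros d continuous_on_polar linear_continuous_on linear.hyps)
  ultimately show ?case unfolding zero_spectrum_def by blast
next
  case (const c)
  then have "zero_spectrum (\<lambda>t. of_real c * d t)"
    unfolding zero_spectrum_def mult.assoc by (auto intro!: continuous_intros)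
  then show ?case by (simp add: mult.commute)
next
  case (add p q)
  then have "zero_spectrum (\<lambda>t. d t * complex_of_real (p (polar r t)) + d t * complex_of_real (q (polar r t)))"
    by (intro zero_spectrum_add) blast+
  then show ?case by (simp add: distrib_left)
next
  case (mult p q)
  then have "zero_spectrum (\<lambda>t. d t * complex_of_real (p (polar r t)) * complex_of_real (q (polar r t)))"
    by blast
  then show ?case by (simp add: mult.assoc)
qed

text \<open>
  The function restricted to the circle is orthogonal to all polynomials, and by the
  Stone-Weierstrass theorem polynomials approximate it uniformly.  So it is orthogonal to itself
  and vanishes.
\<close>
lemma fourier_components_zero_imp_zero:
  fixes F :: "real \<times> real \<Rightarrow> real"
  assumes F: "continuous_on UNIV F" and zero: "\<And>n. fun_component F n r = 0"
    and x: "norm x = r"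
  shows "F x = 0"
proof (cases "r = 0")
  case True
  have "fun_component F 0 r = F x"
    using True x by (simp add: fun_component_def fourier_component_def polar_def zero_prod_def scaleR_conv_of_real)
  then show ?thesis using zero[of 0] by simp
next
  case False
  then have "r > 0" using x norm_ge_zero[of x] by linarith
  define d where "d t = F (polar r t)" for t
  have d: "continuous_on S d" for S
    unfolding d_def by (intro continuous_on_polar[OF F] continuous_intros)
  have "bounded (d ` {0..2*pi})"
    by (intro compact_imp_bounded compact_continuous_image d) auto
  then obtain B where B: "\<And>t. t \<in> {0..2*pi} \<Longrightarrow> \<bar>d t\<bar> \<le> B"
    unfolding bounded_iff by (metis image_eqI real_norm_def)
  have zs: "zero_spectrum (\<lambda>t. complex_of_real (d t))"
    using zero unfolding zero_spectrum_def fun_component_def fourier_component_def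
    by (auto simp: d_def[symmetric] intro!: continuous_intros d)
  have norm_polar: "norm (polar r t) = r" for t
    using \<open>r > 0\<close> by (simp add: polar_def norm_Pair power_mult_distrib flip: distrib_left)
  have le: "integral {0..2*pi} (\<lambda>t. d t * d t) \<le> e * (B * (2 * pi))" if "e > 0" for e
  proof -
    obtain p where p: "real_polynomial_function p" "\<And>x. x \<in> sphere 0 r \<Longrightarrow> \<bar>F x - p x\<bar> < e"
      by (rule Stone_Weierstrass_real_polynomial_function[OF compact_sphere[of 0 r]
          continuous_on_subset[OF F subset_UNIV] \<open>e > 0\<close>]) (rule that)
    have "continuous_on UNIV p"
      by (rule continuous_at_imp_continuous_on) (blast intro: continuous_real_polymonial_function p(1))
    from continuous_on_polar[OF this continuous_on_const continuous_on_id]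
    have pc: "continuous_on S (\<lambda>t. p (polar r t))" for S .
    \<comment> \<open>The zeroth coefficient of the product is the inner product with the polynomial.\<close>
    have "integral {0..2*pi} (\<lambda>t. complex_of_real (d t) * complex_of_real (p (polar r t))) = 0"
      using zero_spectrum_mult_polynomial[OF p(1) zs, of r] unfolding zero_spectrum_def
      by (auto dest!: spec[where x = 0])
    moreover have "((\<lambda>t. complex_of_real (d t * p (polar r t))) has_integral
        complex_of_real (integral {0..2*pi} (\<lambda>t. d t * p (polar r t)))) {0..2*pi}"
      by (intro has_integral_of_real integrable_integral integrable_continuous_real continuous_intros d pc)
    ultimately have p0: "integral {0..2*pi} (\<lambda>t. d t * p (polar r t)) = 0"
      by (simp add: integral_unique)
    have "integral {0..2*pi} (\<lambda>t. d t * d t) = integral {0..2*pi} (\<lambda>t. d t * d t) - integral {0..2*pi} (\<lambda>t. d t * p (polar r t))"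
      using p0 by simp
    also have "\<dots> = integral {0..2*pi} (\<lambda>t. d t * d t - d t * p (polar r t))"
      by (intro integral_diff[symmetric] integrable_continuous_real continuous_intros d pc)
    also have "\<dots> \<le> integral {0..2*pi} (\<lambda>t. B * e)"
    proof (rule integral_le)
      fix t assume t: "t \<in> {0..2*pi}"
      have "d t * d t - d t * p (polar r t) = d t * (d t - p (polar r t))" by (simp add: algebra_simps)
      also have "\<dots> \<le> \<bar>d t\<bar> * \<bar>d t - p (polar r t)\<bar>" by (metis abs_ge_self abs_mult)
      also have "\<dots> \<le> B * e"
        using p(2)[of "polar r t"] B[OF t] norm_polar by (intro mult_mono) (auto simp: d_def)
      finally show "d t * d t - d t * p (polar r t) \<le> B * e" .
    qed (intro integrable_continuous_real continuous_intros d pc)+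
    finally show ?thesis by (simp add: mult_ac)
  qed
  have "integral {0..2*pi} (\<lambda>t. d t * d t) \<le> 0"
  proof (rule field_le_epsilon)
    fix e :: real assume "e > 0"
    have "B \<ge> 0" using B[of 0] by (simp add: order.trans[OF abs_ge_zero])
    show "integral {0..2*pi} (\<lambda>t. d t * d t) \<le> 0 + e"
    proof (cases "B = 0")
      case True
      then show ?thesis using le[of 1] \<open>e > 0\<close> by simp
    next
      case False
      then show ?thesis using le[of "e / (B * (2 * pi))"] \<open>e > 0\<close> \<open>B \<ge> 0\<close> by simp
    qed
  qed
  moreover have "integral {0..2*pi} (\<lambda>t. d t * d t) \<ge> 0"
    by (intro integral_nonneg integrable_continuous_real continuous_intros d) auto
  ultimately have "integral {0..2*pi} (\<lambda>t. d t * d t) = 0" by linarith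
  moreover have "integral {0..2*pi} (\<lambda>t. d t * d t) = 0 \<longleftrightarrow> (\<forall>t\<in>{0..2*pi}. d t * d t = 0)"
    by (rule integral_eq_0_iff) (simp_all add: continuous_on_mult d)
  ultimately have d0: "d t = 0" if "t \<in> {0..2*pi}" for t
    using that by simp
  obtain a b where ab: "x = (a, b)" by (cases x)
  have "(a / r)\<^sup>2 + (b / r)\<^sup>2 = 1"
    using x \<open>r > 0\<close> unfolding ab norm_Pair
    by (simp add: power_divide flip: add_divide_distrib) (metis real_sqrt_pow2_iff real_sqrt_ge_zero sum_power2_ge_zero)
  then obtain t where t: "0 \<le> t" "t < 2 * pi" "a / r = cos t" "b / r = sin t"
    using sincos_total_2pi by metis
  then have "x = polar r t" using \<open>r > 0\<close> unfolding ab polar_def by (simp add: field_simps)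
  then show ?thesis using d0[of t] t by (simp add: d_def)
qed

section \<open>Recovery of the function\<close>

text \<open>
  The open ball misses the support; continuity extends the zeros to its boundary circle.
\<close>
lemma admissible_zero_on_cball:
  assumes "admissible R f" "0 < R" "norm x \<le> R"
  shows "f x = 0"
proof (rule continuous_constant_on_closure[where f = f and S = "ball 0 R"])
  show "continuous_on (closure (ball 0 R)) f"
    using assms(1) unfolding admissible_def by (blast intro: continuous_on_subset)
  show "f y = 0" if "y \<in> ball 0 R" for y :: "real \<times> real"
  proof (rule ccontr)
    assume "f y \<noteq> 0"
    then have "y \<in> closure {x. f x \<noteq> 0}" by (intro subsetD[OF closure_subset]) simp
    then show False using assms(1) that unfolding admissible_def by blast
  qed
  show "x \<in> closure (ball 0 R)" using assms by (simp add: closure_ball)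
qed

lemma fun_component_diff:
  assumes "continuous_on UNIV f" "continuous_on UNIV g"
  shows "fun_component (\<lambda>x. f x - g x) n r = fun_component f n r - fun_component g n r"
proof -
  have "integral {0..2 * pi} (\<lambda>t. complex_of_real (f (polar r t)) * exp (- \<i> * of_int n * complex_of_real t)
      - complex_of_real (g (polar r t)) * exp (- \<i> * of_int n * complex_of_real t))
    = integral {0..2 * pi} (\<lambda>t. complex_of_real (f (polar r t)) * exp (- \<i> * of_int n * complex_of_real t))
    - integral {0..2 * pi} (\<lambda>t. complex_of_real (g (polar r t)) * exp (- \<i> * of_int n * complex_of_real t))"
    by (intro integral_diff integrable_continuous_real continuous_intros continuous_on_polar assms)
  then show ?thesis
    unfolding fun_component_def fourier_component_def by (simp add: left_diff_distrib right_diff_distrib)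
qed

theorem proposition1:
  fixes R :: real and f :: "real \<times> real \<Rightarrow> real"
  assumes "R > 0" and "admissible R f"
  shows "(\<forall>(n::int) r. r > R \<longrightarrow>
            inversion_integrand R f n r absolutely_integrable_on {R..r} \<and>
            (\<lambda>s. integral {R..s} (inversion_integrand R f n s)) differentiable (at r) \<and>
            fun_component f n r =
              complex_of_real (1 / pi) *
              vector_derivative (\<lambda>s. integral {R..s} (inversion_integrand R f n s)) (at r)) \<and>
         (\<forall>g. admissible R g \<and>
              (\<forall>(n::int) \<rho>. \<rho> \<ge> R \<longrightarrow> radon_component R g n \<rho> = radon_component R f n \<rho>)
              \<longrightarrow> g = f)"
proof -
  have cont: "continuous_on UNIV h" if "admissible R h" for h
    using that by (simp add: admissible_def)
  have recover: "fun_component h n r = complex_of_real (1 / pi) *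
      vector_derivative (\<lambda>s. integral {R..s} (inversion_integrand R h n s)) (at r)"
    if "admissible R h" "r > R" for h n r
    unfolding vector_derivative_at[OF inversion_has_vector_derivative[OF cont[OF that(1)] \<open>R > 0\<close> that(2)]]
    by (simp add: scaleR_conv_of_real)
  have "g = f" if g: "admissible R g"
    and eq: "\<forall>(n::int) \<rho>. \<rho> \<ge> R \<longrightarrow> radon_component R g n \<rho> = radon_component R f n \<rho>" for g
  proof
    fix x
    show "g x = f x"
    proof (cases "norm x \<le> R")
      case True
      then show ?thesis using admissible_zero_on_cball \<open>R > 0\<close> g assms(2) by metis
    next
      case False
      \<comment> \<open>The data determine the integral as a function of s, hence its derivative.\<close>
      have "integral {R..s} (inversion_integrand R g n s) = integral {R..s} (inversion_integrand R f n s)" for n s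
        by (rule integral_cong) (simp add: inversion_integrand_def eq)
      then have "fun_component g n (norm x) = fun_component f n (norm x)" for n
        using recover[OF g] recover[OF assms(2)] False by simp
      then have "fun_component (\<lambda>x. g x - f x) n (norm x) = 0" for n
        by (simp add: fun_component_diff cont g assms(2))
      then have "g x - f x = 0"
        by (rule fourier_components_zero_imp_zero[OF
              continuous_on_diff[OF cont[OF g] cont[OF assms(2)]] _ refl])
      then show ?thesis by simp
    qed
  qed
  moreover have "(\<lambda>s. integral {R..s} (inversion_integrand R f n s)) differentiable (at r)" if "r > R" for n r
    using inversion_has_vector_derivative[OF cont[OF assms(2)] \<open>R > 0\<close> that] by (rule differentiableI_vector)
  ultimately show ?thesis
    using recover[OF assms(2)] integral_inversion_integrand(1)[OF cont[OF assms(2)] \<open>R > 0\<close>] by blast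
qed

end
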